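(* Let $m\ge 1$ and let $C_m$ be the cyclic biquandle of order $m$. For every integer $n\ge 1$: (1) $\operatorname{rank} H_n^{YB}(C_m)=m^{n-1}$; (2) $\operatorname{rank} H_n^{D}(C_m)=m^{n-1}-(m-1)^{n-1}$; (3) $\operatorname{rank} H_n^{NYB}(C_m)=(m-1)^{n-1}$. (Here $0^0=1$.)
   Context: The cyclic biquandle $C_m$ of order $m$ is the set $\mathbb{Z}/m\mathbb{Z}$ with the map $R(a,b)=(b+1,a-1)$. Its set-theoretic Yang-Baxter chain complex: for $n\ge 1$, $C_n^{YB}(C_m)$ is the free abelian group with basis $(C_m)^n$, and $C_n^{YB}(C_m)=0$ for $n\le 0$. The boundary is $\partial_n=\sum_{i=1}^n(-1)^{i-1}(d^l_{i,n}-d^r_{i,n})$ for $n\ge 2$ (and $\partial_n=0$ for $n\le 1$), where on basis elements $$d^l_{i,n}(x_1,\ldots,x_n)=(x_1-1,\ldots,x_{i-1}-1,x_{i+1},\ldots,x_n),$$ $$d^r_{i,n}(x_1,\ldots,x_n)=(x_1,\ldots,x_{i-1},x_{i+1}+1,\ldots,x_n+1).$$ For $n\ge 2$ the degenerate subgroup $C_n^D(C_m)\subseteq C_n^{YB}(C_m)$ is spanned by the tuples $(x_1,\ldots,x_n)$ with $R(x_i,x_{i+1})=(x_i,x_{i+1})$, i.e. $x_i=x_{i+1}+1$, for some $1\le i\le n-1$; $C_n^D(C_m)=0$ for $n\le 1$. These form a subcomplex, and $C_*^{NYB}(C_m)=C_*^{YB}(C_m)/C_*^D(C_m)$ is the quotient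 complex. $H_n^{YB}$, $H_n^{D}$, $H_n^{NYB}$ denote the (integral) homology groups of $C_*^{YB}$, $C_*^{D}$, $C_*^{NYB}$ respectively. The rank of a finitely generated abelian group is the rank of its free part. *)

theory Defs
  imports "HOL-Algebra.Algebra"
begin

section \<open>Rank and homology\<close>

definition torsion_subgroup :: "('a, 'b) monoid_scheme \<Rightarrow> 'a set" where
  "torsion_subgroup G = {x \<in> carrier G. \<exists>k::nat. k > 0 \<and> x [^]\<^bsub>G\<^esub> k = \<one>\<^bsub>G\<^esub>}"

text \<open>The free part of a finitely generated abelian group is its quotient by the torsion
  subgroup. The rank is unspecified if that quotient is not free of finite rank.\<close>

definition group_rank :: "('a, 'b) monoid_scheme \<Rightarrow> nat" where
  "group_rank G = (THE r. G Mod torsion_subgroup G \<cong> free_Abelian_group {..<r})"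

lemma (in comm_group) subgroup_torsion_subgroup: "subgroup (torsion_subgroup G) G"
proof (rule subgroupI)
  show "torsion_subgroup G \<subseteq> carrier G" "torsion_subgroup G \<noteq> {}"
    by (auto simp: torsion_subgroup_def intro!: exI[of _ "\<one>"] exI[of _ 1])
next
  fix x assume "x \<in> torsion_subgroup G"
  then show "inv x \<in> torsion_subgroup G"
    by (auto simp: torsion_subgroup_def nat_pow_inv)
next
  fix x y assume "x \<in> torsion_subgroup G" "y \<in> torsion_subgroup G"
  then obtain k l :: nat where *: "x \<in> carrier G" "y \<in> carrier G" "k > 0" "l > 0"
      "x [^] k = \<one>" "y [^] l = \<one>"
    by (auto simp: torsion_subgroup_def)
  have "x [^] (k * l) = \<one>" "y [^] (k * l) = \<one>"
    using * by (metis nat_pow_pow nat_pow_one, metis mult.commute nat_pow_pow nat_pow_one)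
  then have "(x \<otimes> y) [^] (k * l) = \<one>"
    using * by (simp add: pow_mult_distrib m_comm)
  then show "x \<otimes> y \<in> torsion_subgroup G"
    using * by (auto simp: torsion_subgroup_def intro!: exI[of _ "k * l"])
qed

lemma (in comm_group) group_rank_eqI:
  fixes r :: nat
  assumes "G Mod torsion_subgroup G \<cong> free_Abelian_group {..<r}"
  shows "group_rank G = r"
  unfolding group_rank_def
proof (rule the_equality)
  fix s :: nat assume s: "G Mod torsion_subgroup G \<cong> free_Abelian_group {..<s}"
  have "group (G Mod torsion_subgroup G)"
    by (intro normal.factorgroup_is_group subgroup_imp_normal subgroup_torsion_subgroup)
  then have "free_Abelian_group {..<s} \<cong> free_Abelian_group {..<r}"
    using assms s by (meson group.iso_sym iso_trans)
  then have "{..<s} \<approx> {..<r}"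
    by (simp add: isomorphic_free_Abelian_groups)
  then show "s = r"
    by (simp add: eqpoll_iff_card)
qed (rule assms)

text \<open>A complex is a family \<open>C\<close> of abelian groups with \<open>d n\<close> mapping \<open>C n\<close> to \<open>C (n - 1)\<close>,
  indexed by the natural numbers. All complexes below vanish in degree 0, so the truncated
  \<open>0 - 1 = 0\<close> is harmless.\<close>

definition homology ::
    "(nat \<Rightarrow> ('a, 'b) monoid_scheme) \<Rightarrow> (nat \<Rightarrow> 'a \<Rightarrow> 'a) \<Rightarrow> nat \<Rightarrow> 'a set monoid" where
  "homology C d n =
     (C n)\<lparr>carrier := kernel (C n) (C (n - 1)) (d n)\<rparr> Mod (d (n + 1) ` carrier (C (n + 1)))"


section \<open>The cyclic biquandle and its chain complexes\<close>

text \<open>\<open>\<int>/m\<int>\<close> is represented by the residues \<open>{0..<m}\<close>.\<close>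

definition cyc :: "nat \<Rightarrow> int set" where
  "cyc m = {0..<int m}"

definition cyc_R :: "nat \<Rightarrow> int \<times> int \<Rightarrow> int \<times> int" where
  "cyc_R m = (\<lambda>(a, b). ((b + 1) mod int m, (a - 1) mod int m))"

text \<open>The basis in degree \<open>n\<close>; empty for \<open>n = 0\<close>, since the complex vanishes there.\<close>

definition tuples :: "nat \<Rightarrow> nat \<Rightarrow> int list set" where
  "tuples m n = {xs. n \<ge> 1 \<and> length xs = n \<and> set xs \<subseteq> cyc m}"

text \<open>Entry \<open>x\<^sub>i\<close> of a tuple is \<open>xs ! (i - 1)\<close>, as lists are indexed from 0.\<close>

definition face_l :: "nat \<Rightarrow> nat \<Rightarrow> int list \<Rightarrow> int list" where
  "face_l m i xs = map (\<lambda>x. (x - 1) mod int m) (take (i - 1) xs) @ drop i xs"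

definition face_r :: "nat \<Rightarrow> nat \<Rightarrow> int list \<Rightarrow> int list" where
  "face_r m i xs = take (i - 1) xs @ map (\<lambda>x. (x + 1) mod int m) (drop i xs)"

definition boundary :: "nat \<Rightarrow> nat \<Rightarrow> (int list \<Rightarrow>\<^sub>0 int) \<Rightarrow> (int list \<Rightarrow>\<^sub>0 int)" where
  "boundary m n c =
     (if n \<ge> 2
      then frag_extend (\<lambda>xs. \<Sum>i = 1..n. frag_cmul ((-1) ^ (i - 1))
                               (frag_of (face_l m i xs) - frag_of (face_r m i xs))) c
      else 0)"

definition YB :: "nat \<Rightarrow> nat \<Rightarrow> (int list \<Rightarrow>\<^sub>0 int) monoid" where
  "YB m n = free_Abelian_group (tuples m n)"

text \<open>No tuple of length at most 1 is degenerate.\<close>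

definition degenerate_tuples :: "nat \<Rightarrow> nat \<Rightarrow> int list set" where
  "degenerate_tuples m n =
     {xs \<in> tuples m n. \<exists>i \<in> {1..<n}.
        cyc_R m (xs ! (i - 1), xs ! i) = (xs ! (i - 1), xs ! i)}"

definition DYB :: "nat \<Rightarrow> nat \<Rightarrow> (int list \<Rightarrow>\<^sub>0 int) monoid" where
  "DYB m n = subgroup_generated (YB m n) (frag_of ` degenerate_tuples m n)"

definition NYB :: "nat \<Rightarrow> nat \<Rightarrow> (int list \<Rightarrow>\<^sub>0 int) set monoid" where
  "NYB m n = YB m n Mod carrier (DYB m n)"

text \<open>The induced map sends the coset \<open>A = D\<^sub>n + c\<close> to the coset \<open>D\<^sub>n\<^sub>-\<^sub>1 + boundary m n c\<close>. This
  does not depend on \<open>c\<close> and equals \<open>D\<^sub>n\<^sub>-\<^sub>1 + boundary m n ` A\<close>, because the boundary maps the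
  degenerate subgroup \<open>D\<^sub>n\<close> into \<open>D\<^sub>n\<^sub>-\<^sub>1\<close>.\<close>

definition NYB_boundary ::
    "nat \<Rightarrow> nat \<Rightarrow> (int list \<Rightarrow>\<^sub>0 int) set \<Rightarrow> (int list \<Rightarrow>\<^sub>0 int) set" where
  "NYB_boundary m n A =
     carrier (DYB m (n - 1)) <#>\<^bsub>YB m (n - 1)\<^esub> boundary m n ` A"

definition H_YB :: "nat \<Rightarrow> nat \<Rightarrow> (int list \<Rightarrow>\<^sub>0 int) set monoid" where
  "H_YB m = homology (YB m) (boundary m)"

definition H_D :: "nat \<Rightarrow> nat \<Rightarrow> (int list \<Rightarrow>\<^sub>0 int) set monoid" where
  "H_D m = homology (DYB m) (boundary m)"

definition H_NYB :: "nat \<Rightarrow> nat \<Rightarrow> (int list \<Rightarrow>\<^sub>0 int) set set monoid" where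
  "H_NYB m = homology (NYB m) (NYB_boundary m)"

end

theory Submission
  imports Defs
begin

text \<open>Let \<open>T\<close> be the simultaneous shift of all entries by \<open>-1\<close> and
  \<open>\<delta> = \<Sum>(-1)\<^sup>i\<^sup>-\<^sup>1 d\<^sup>r\<^sub>i\<close>. Since \<open>d\<^sup>l\<^sub>i = T d\<^sup>r\<^sub>i\<close>, the boundary is \<open>(T - 1) \<delta>\<close>, where \<open>T\<close> commutes
  with \<open>\<delta>\<close> and has order \<open>m\<close>. After the substitution \<open>y\<^sub>i = x\<^sub>i + i\<close>, \<open>\<delta>\<close> is the boundary of a full
  simplex (with augmentation) and the degenerate tuples are the degenerate simplices; so \<open>\<delta>\<close> is
  contractible on all three complexes by coning. Rationally a complex splits into the
  \<open>T\<close>-invariants, on which the boundary vanishes, and a complement on which \<open>T - 1\<close> is invertible and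
  which is therefore acyclic. Hence the rank of \<open>H\<^sub>n\<close> is the number of \<open>T\<close>-orbits of basis tuples in
  degree \<open>n\<close>, and an orbit is determined by its list of consecutive differences.\<close>

section \<open>Rank of an abelian group\<close>

text \<open>This is the inductive argument that subgroups of free abelian groups are free. The
  multiples \<open>frag_cmul k (frag_of i)\<close> in \<open>S\<close> prevent a loss of rank, so
  the basis \<open>b\<close> can be indexed by \<open>I\<close> itself.\<close>

lemma full_rank_subgroup_free:
  assumes "finite I" and "k > 0"
    and "\<And>x. x \<in> S \<Longrightarrow> Poly_Mapping.keys x \<subseteq> I"
    and "\<And>x y. x \<in> S \<Longrightarrow> y \<in> S \<Longrightarrow> x - y \<in> S"
    and "0 \<in> S" and "\<And>i. i \<in> I \<Longrightarrow> frag_cmul k (frag_of i) \<in> S"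
  shows "\<exists>b. (\<forall>c. Poly_Mapping.keys c \<subseteq> I \<longrightarrow> frag_extend b c \<in> S) \<and>
             (\<forall>x\<in>S. \<exists>c. Poly_Mapping.keys c \<subseteq> I \<and> x = frag_extend b c) \<and>
             (\<forall>c. Poly_Mapping.keys c \<subseteq> I \<longrightarrow> frag_extend b c = 0 \<longrightarrow> c = 0)"
  using assms(1,3-)
proof (induction I arbitrary: S rule: finite_induct)
  case empty
  then show ?case by auto
next
  case (insert j I)
  define S' where "S' = {x \<in> S. Poly_Mapping.keys x \<subseteq> I}"
  have keys_I: "Poly_Mapping.keys x \<subseteq> I" if "x \<in> S" "Poly_Mapping.lookup x j = 0" for x
    using insert.prems(1)[OF that(1)] that(2) by (auto simp: in_keys_iff)
  have add: "x + y \<in> S" if "x \<in> S" "y \<in> S" for x y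
    using insert.prems(2)[OF that(1) insert.prems(2)[OF insert.prems(3) that(2)]] by simp
  have cmul: "frag_cmul q x \<in> S" if "x \<in> S" for q x
    by (rule frag_closure_minus_cmul) (use insert.prems that in auto)
  have "\<exists>b. (\<forall>c. Poly_Mapping.keys c \<subseteq> I \<longrightarrow> frag_extend b c \<in> S') \<and>
             (\<forall>x\<in>S'. \<exists>c. Poly_Mapping.keys c \<subseteq> I \<and> x = frag_extend b c) \<and>
             (\<forall>c. Poly_Mapping.keys c \<subseteq> I \<longrightarrow> frag_extend b c = 0 \<longrightarrow> c = 0)"
    by (rule insert.IH) (use insert.prems in \<open>auto simp: S'_def dest: subsetD[OF keys_diff]\<close>)
  then obtain b where b: "\<And>c. Poly_Mapping.keys c \<subseteq> I \<Longrightarrow> frag_extend b c \<in> S'"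
      "\<And>x. x \<in> S' \<Longrightarrow> \<exists>c. Poly_Mapping.keys c \<subseteq> I \<and> x = frag_extend b c"
      "\<And>c. Poly_Mapping.keys c \<subseteq> I \<Longrightarrow> frag_extend b c = 0 \<Longrightarrow> c = 0"
    by blast
  \<comment> \<open>The \<open>j\<close>-coordinates of elements of \<open>S\<close> form an ideal
    of the integers; \<open>d\<close> is its positive generator and \<open>s\<close> an element
    attaining it. It is nonzero because \<open>frag_cmul k (frag_of j)\<close> lies in
    \<open>S\<close>.\<close>
  define P where "P = (\<lambda>n. n > 0 \<and> (\<exists>x\<in>S. Poly_Mapping.lookup x j = int n))"
  have "P (nat k)"
    unfolding P_def using \<open>k > 0\<close> insert.prems(4)[of j]
    by (auto intro!: bexI[of _ "frag_cmul k (frag_of j)"])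
  then have "P (LEAST n. P n)" by (rule LeastI)
  then obtain d s where d: "d = (LEAST n. P n)" "d > 0" "s \<in> S" "Poly_Mapping.lookup s j = int d"
    by (auto simp: P_def)
  \<comment> \<open>Division with remainder: a nonzero remainder would be a smaller positive
    coordinate.\<close>
  have dvd: "int d dvd Poly_Mapping.lookup x j" if "x \<in> S" for x
  proof (rule ccontr)
    assume "\<not> int d dvd Poly_Mapping.lookup x j"
    moreover define r where "r = Poly_Mapping.lookup x j mod int d"
    ultimately have r: "0 < r" "r < int d"
      using \<open>d > 0\<close> pos_mod_sign[of "int d" "Poly_Mapping.lookup x j"]
        pos_mod_bound[of "int d" "Poly_Mapping.lookup x j"] by (auto simp: dvd_eq_mod_eq_0 order.order_iff_strict)
    have "Poly_Mapping.lookup (x - frag_cmul (Poly_Mapping.lookup x j div int d) s) j = r"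
      by (simp add: r_def lookup_minus d minus_div_mult_eq_mod)
    moreover have "x - frag_cmul (Poly_Mapping.lookup x j div int d) s \<in> S"
      using insert.prems that cmul d by blast
    ultimately have "P (nat r)"
      using r by (auto simp: P_def)
    then have "d \<le> nat r"
      unfolding d by (rule Least_le)
    then show False using r by linarith
  qed
  \<comment> \<open>\<open>S\<close> is the direct sum of \<open>S'\<close> and the multiples of
    \<open>s\<close>, so \<open>s\<close> joins the basis of \<open>S'\<close> as the member indexed
    by \<open>j\<close>.\<close>
  define b' where "b' = b(j := s)"
  have b'_I: "frag_extend b' c = frag_extend b c" if "Poly_Mapping.keys c \<subseteq> I" for c
    using that \<open>j \<notin> I\<close> by (intro frag_extend_eq) (auto simp: b'_def)
  have b'_j: "frag_extend b' (frag_cmul q (frag_of j)) = frag_cmul q s" for q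
    by (simp add: frag_extend_cmul b'_def)
  have split: "Poly_Mapping.keys (c - frag_cmul (Poly_Mapping.lookup c j) (frag_of j)) \<subseteq> I"
    if "Poly_Mapping.keys c \<subseteq> insert j I" for c :: "'a \<Rightarrow>\<^sub>0 int"
    using that by (auto simp: in_keys_iff lookup_minus split: if_splits)
  have b'_split: "frag_extend b' c =
      frag_extend b (c - frag_cmul (Poly_Mapping.lookup c j) (frag_of j)) + frag_cmul (Poly_Mapping.lookup c j) s"
    if "Poly_Mapping.keys c \<subseteq> insert j I" for c
    using b'_I[OF split[OF that]] b'_j[of "Poly_Mapping.lookup c j"]
    by (metis diff_add_cancel frag_extend_diff)
  show ?case
  proof (intro exI[of _ b'] conjI allI ballI impI)
    fix c :: "'a \<Rightarrow>\<^sub>0 int" assume c: "Poly_Mapping.keys c \<subseteq> insert j I"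
    show "frag_extend b' c \<in> S"
      using b(1)[OF split[OF c]] d cmul add by (auto simp: b'_split[OF c] S'_def)
    assume "frag_extend b' c = 0"
    moreover have "Poly_Mapping.lookup (frag_extend b (c - frag_cmul (Poly_Mapping.lookup c j) (frag_of j))) j = 0"
      using b(1)[OF split[OF c]] \<open>j \<notin> I\<close> by (auto simp: S'_def in_keys_iff)
    ultimately have "Poly_Mapping.lookup c j * int d = 0"
      using b'_split[OF c] d by (metis add_0 lookup_add lookup_frag_cmul lookup_zero)
    then have j0: "Poly_Mapping.lookup c j = 0" using \<open>d > 0\<close> by simp
    then have "Poly_Mapping.keys c \<subseteq> I" using split[OF c] by simp
    then show "c = 0"
      using b(3) b'_I \<open>frag_extend b' c = 0\<close> by simp
  next
    fix x assume x: "x \<in> S"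
    then obtain q where q: "Poly_Mapping.lookup x j = int d * q" using dvd by blast
    have "x - frag_cmul q s \<in> S"
      using insert.prems x cmul d by blast
    then have "x - frag_cmul q s \<in> S'"
      using d q by (auto simp: S'_def lookup_minus intro!: keys_I[THEN subsetD])
    then obtain c where c: "Poly_Mapping.keys c \<subseteq> I" "x - frag_cmul q s = frag_extend b c"
      using b(2) by blast
    have "x = frag_extend b' (c + frag_cmul q (frag_of j))"
      using c b'_I[OF c(1)] b'_j[of q] by (simp add: frag_extend_add) (metis diff_add_cancel)
    moreover have "Poly_Mapping.keys (c + frag_cmul q (frag_of j)) \<subseteq> insert j I"
      using c(1) keys_add[of c "frag_cmul q (frag_of j)"] by (auto split: if_splits)
    ultimately show "\<exists>c. Poly_Mapping.keys c \<subseteq> insert j I \<and> x = frag_extend b' c"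
      by blast
  qed
qed

text \<open>Free abelian groups are torsion-free, so the kernel of \<open>h\<close> is exactly the
  torsion subgroup and the free part is isomorphic to the image of \<open>h\<close>. This image
  contains all \<open>k\<close>-multiples, hence is free of rank \<open>card I\<close>. Thus a map
  that is an isomorphism only rationally determines the rank.\<close>

lemma (in comm_group) group_rank_eq_cardI:
  fixes h :: "'a \<Rightarrow> 'i \<Rightarrow>\<^sub>0 int"
  assumes "finite I" and h: "h \<in> hom G (free_Abelian_group I)"
    and "k > 0" and k: "\<And>i. i \<in> I \<Longrightarrow> frag_cmul k (frag_of i) \<in> h ` carrier G"
    and ker: "\<And>x. x \<in> carrier G \<Longrightarrow> h x = 0 \<Longrightarrow> x \<in> torsion_subgroup G"
  shows "group_rank G = card I"
proof (rule group_rank_eqI)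
  let ?F = "free_Abelian_group I"
  interpret h: group_hom G ?F h
    using h by (simp add: group_hom_def group_hom_axioms_def is_group)
  have S: "subgroup (h ` carrier G) ?F" by (rule h.img_is_subgroup)
  have diff: "x - y \<in> h ` carrier G" if "x \<in> h ` carrier G" "y \<in> h ` carrier G" for x y
  proof -
    have "Poly_Mapping.keys y \<subseteq> I" using that S subgroup.mem_carrier by fastforce
    then show ?thesis
      using subgroup.m_closed[OF S that(1) subgroup.m_inv_closed[OF S that(2)]] by simp
  qed
  have "\<exists>b. (\<forall>c. Poly_Mapping.keys c \<subseteq> I \<longrightarrow> frag_extend b c \<in> h ` carrier G) \<and>
             (\<forall>x\<in>h ` carrier G. \<exists>c. Poly_Mapping.keys c \<subseteq> I \<and> x = frag_extend b c) \<and>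
             (\<forall>c. Poly_Mapping.keys c \<subseteq> I \<longrightarrow> frag_extend b c = 0 \<longrightarrow> c = 0)"
    using subgroup.mem_carrier[OF S] subgroup.one_closed[OF S] diff k
    by (intro full_rank_subgroup_free[OF \<open>finite I\<close> \<open>k > 0\<close>]) auto
  then obtain b where b: "\<And>c. Poly_Mapping.keys c \<subseteq> I \<Longrightarrow> frag_extend b c \<in> h ` carrier G"
      "\<And>x. x \<in> h ` carrier G \<Longrightarrow> \<exists>c. Poly_Mapping.keys c \<subseteq> I \<and> x = frag_extend b c"
      "\<And>c. Poly_Mapping.keys c \<subseteq> I \<Longrightarrow> frag_extend b c = 0 \<Longrightarrow> c = 0"
    by blast
  let ?H = "?F\<lparr>carrier := h ` carrier G\<rparr>"
  have H: "group ?H" using S h.H.subgroup_imp_group by blast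
  have ker_eq: "kernel G ?H h = torsion_subgroup G"
  proof (intro Set.set_eqI iffI)
    fix x assume "x \<in> torsion_subgroup G"
    then obtain l :: nat where l: "x \<in> carrier G" "l > 0" "x [^] l = \<one>"
      by (auto simp: torsion_subgroup_def)
    then have "frag_cmul (int l) (h x) = 0"
      by (metis h.hom_nat_pow h.hom_one one_free_Abelian_group pow_free_Abelian_group)
    then show "x \<in> kernel G ?H h" using l by (simp add: kernel_def)
  qed (auto simp: kernel_def ker)
  interpret h': group_hom G ?H h
    using H h by (auto simp: group_hom_def group_hom_axioms_def is_group hom_def)
  have "G Mod torsion_subgroup G \<cong> ?H"
    using h'.FactGroup_iso by (simp add: ker_eq)
  also have "?F \<cong> ?H"
  proof (rule is_isoI, rule isoI)
    show "frag_extend b \<in> hom ?F ?H"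
      using b(1) by (auto simp: hom_def frag_extend_add)
    show "bij_betw (frag_extend b) (carrier ?F) (carrier ?H)"
      unfolding bij_betw_def inj_on_def
    proof (intro conjI ballI impI)
      fix c c' assume c: "c \<in> carrier ?F" "c' \<in> carrier ?F" "frag_extend b c = frag_extend b c'"
      then have "Poly_Mapping.keys (c - c') \<subseteq> I"
        using keys_diff[of c c'] by (meson Un_least carrier_free_Abelian_group_iff order_trans)
      then have "c - c' = 0"
        by (rule b(3)) (simp add: c(3) frag_extend_diff)
      then show "c = c'" by simp
    next
      have "x \<in> frag_extend b ` carrier ?F" if "x \<in> h ` carrier G" for x
        using b(2)[OF that] by auto
      then show "frag_extend b ` carrier ?F = carrier ?H"
        using b(1) by force
    qed
  qed
  then have "?H \<cong> ?F" by (simp add: group.iso_sym)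
  also have "?F \<cong> free_Abelian_group {..<card I}"
    using \<open>finite I\<close> by (simp add: isomorphic_free_Abelian_groups eqpoll_iff_card)
  finally (iso_trans) show "G Mod torsion_subgroup G \<cong> free_Abelian_group {..<card I}" .
qed

section \<open>The shift, the simplicial boundary and cones\<close>

definition shift :: "nat \<Rightarrow> int list \<Rightarrow> int list" where
  "shift m = map (\<lambda>x. (x - 1) mod int m)"

definition shift_chain :: "nat \<Rightarrow> (int list \<Rightarrow>\<^sub>0 int) \<Rightarrow> (int list \<Rightarrow>\<^sub>0 int)" where
  "shift_chain m = frag_extend (frag_of \<circ> shift m)"

text \<open>On tuples of length 1 this is the augmentation, with values in the multiples of the empty tuple.
  The empty tuple is fixed by the shift, so \<open>(T - 1) \<delta>\<close> still vanishes there, as \<open>boundary m 1\<close> does.\<close>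

definition simplicial_boundary :: "nat \<Rightarrow> (int list \<Rightarrow>\<^sub>0 int) \<Rightarrow> (int list \<Rightarrow>\<^sub>0 int)" where
  "simplicial_boundary m =
     frag_extend (\<lambda>xs. \<Sum>i = 1..length xs. frag_cmul ((-1) ^ (i - 1)) (frag_of (face_r m i xs)))"

text \<open>In the coordinates y_i = x_i + i this prepends a vertex and changes no other: an entry
  moved one position to the right must decrease by 1 to keep its y-value.\<close>

definition cone :: "nat \<Rightarrow> int \<Rightarrow> (int list \<Rightarrow>\<^sub>0 int) \<Rightarrow> (int list \<Rightarrow>\<^sub>0 int)" where
  "cone m a = frag_extend (frag_of \<circ> (\<lambda>xs. a # shift m xs))"

text \<open>The support set \<open>S\<close> is there because several identities below hold only for
  tuples whose entries are residues.\<close>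

lemma frag_additive_eqI:
  assumes "Poly_Mapping.keys c \<subseteq> S"
    and "\<And>xs. xs \<in> S \<Longrightarrow> f (frag_of xs) = g (frag_of xs)"
    and "\<And>x y. f (x - y) = f x - f y" and "\<And>x y. g (x - y) = g x - g y"
  shows "f c = (g c :: 'a :: ab_group_add)"
proof -
  have "f 0 = 0" "g 0 = 0"
    using assms(3)[of 0 0] assms(4)[of 0 0] by auto
  with assms(1) show ?thesis
    by (induction c rule: frag_induction) (use assms in auto)
qed

lemma frag_cmul_diff_distrib2: "frag_cmul k (x - y) = frag_cmul k x - frag_cmul k y"
  using frag_cmul_distrib2[of k "x - y" y] by simp

lemma length_shift [simp]: "length (shift m xs) = length xs"
  by (simp add: shift_def)

lemma set_shift: "m > 0 \<Longrightarrow> set (shift m xs) \<subseteq> cyc m"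
  by (auto simp: shift_def cyc_def)

lemma shift_funpow:
  "set xs \<subseteq> cyc m \<Longrightarrow> (shift m ^^ j) xs = map (\<lambda>x. (x - int j) mod int m) xs"
proof (induction j)
  case 0
  then show ?case by (auto simp: cyc_def intro!: map_idI[symmetric])
next
  case (Suc j)
  then show ?case by (simp add: shift_def algebra_simps mod_diff_left_eq)
qed

lemma shift_funpow_order: "set xs \<subseteq> cyc m \<Longrightarrow> (shift m ^^ m) xs = xs"
  by (auto simp: shift_funpow cyc_def intro!: map_idI)

lemma shift_face_r: "shift m (face_r m i xs) = face_r m i (shift m xs)"
  by (simp add: shift_def face_r_def take_map drop_map mod_simps)

text \<open>Behind position \<open>i\<close> the +1 of \<open>face_r\<close> and the -1 of the shift
  cancel modulo \<open>m\<close>, and reduction fixes residues.\<close>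

lemma shift_face_r_eq_face_l:
  assumes "set xs \<subseteq> cyc m"
  shows "shift m (face_r m i xs) = face_l m i xs"
proof -
  have "(x + 1 - 1) mod int m = x" if "x \<in> set (drop i xs)" for x
    using that assms in_set_dropD[of x i xs] by (auto simp: cyc_def)
  then show ?thesis
    by (auto simp: shift_def face_r_def face_l_def mod_simps intro!: map_idI)
qed

text \<open>These are the faces of a cone with apex \<open>a\<close>: the first is its base, the
  others are cones over faces of the base. The index moves by one because the apex occupies position
  1.\<close>

lemma face_r_Cons_shift:
  assumes "set xs \<subseteq> cyc m"
  shows "face_r m 1 (a # shift m xs) = xs"
    and "i \<ge> 1 \<Longrightarrow> face_r m (Suc i) (a # shift m xs) = a # shift m (face_r m i xs)"
proof -
  show "face_r m 1 (a # shift m xs) = xs"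
    using assms by (auto simp: face_r_def shift_def mod_simps cyc_def intro!: map_idI)
  show "i \<ge> 1 \<Longrightarrow> face_r m (Suc i) (a # shift m xs) = a # shift m (face_r m i xs)"
    by (cases i) (simp_all add: face_r_def shift_def take_map drop_map mod_simps)
qed

lemma shift_chain_diff [simp]: "shift_chain m (x - y) = shift_chain m x - shift_chain m y"
  by (simp add: shift_chain_def frag_extend_diff)

lemma simplicial_boundary_diff [simp]:
  "simplicial_boundary m (x - y) = simplicial_boundary m x - simplicial_boundary m y"
  by (simp add: simplicial_boundary_def frag_extend_diff)

lemma cone_diff [simp]: "cone m a (x - y) = cone m a x - cone m a y"
  by (simp add: cone_def frag_extend_diff)

lemma shift_chain_frag_of [simp]: "shift_chain m (frag_of xs) = frag_of (shift m xs)"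
  by (simp add: shift_chain_def)

lemma cone_frag_of [simp]: "cone m a (frag_of xs) = frag_of (a # shift m xs)"
  by (simp add: cone_def)

lemma keys_shift_chain: "Poly_Mapping.keys (shift_chain m c) \<subseteq> shift m ` Poly_Mapping.keys c"
  using keys_frag_extend[of "frag_of \<circ> shift m" c] by (auto simp: shift_chain_def)

lemma keys_cone: "Poly_Mapping.keys (cone m a c) \<subseteq> (\<lambda>xs. a # shift m xs) ` Poly_Mapping.keys c"
  using keys_frag_extend[of "frag_of \<circ> (\<lambda>xs. a # shift m xs)" c] by (auto simp: cone_def)

lemma shift_chain_simplicial_boundary:
  "shift_chain m (simplicial_boundary m c) = simplicial_boundary m (shift_chain m c)"
proof (rule frag_additive_eqI[of c UNIV])
  show "shift_chain m (simplicial_boundary m (frag_of xs)) =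
      simplicial_boundary m (shift_chain m (frag_of xs))" for xs
    by (simp add: simplicial_boundary_def shift_chain_def frag_extend_sum frag_extend_cmul shift_face_r)
qed simp_all

lemma boundary_eq:
  assumes "n \<ge> 1" and "Poly_Mapping.keys c \<subseteq> tuples m n"
  shows "boundary m n c = shift_chain m (simplicial_boundary m c) - simplicial_boundary m c"
proof (cases "n = 1")
  case True
  show ?thesis
    by (rule frag_additive_eqI[OF assms(2)])
      (auto simp: True boundary_def tuples_def simplicial_boundary_def face_r_def shift_def
        length_Suc_conv frag_extend_diff)
next
  case False
  show ?thesis
  proof (rule frag_additive_eqI[OF assms(2)])
    fix xs assume "xs \<in> tuples m n"
    then show "boundary m n (frag_of xs) =
        shift_chain m (simplicial_boundary m (frag_of xs)) - simplicial_boundary m (frag_of xs)"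
      using False assms(1)
      by (simp add: boundary_def tuples_def simplicial_boundary_def shift_chain_def frag_extend_sum
        frag_extend_cmul shift_face_r_eq_face_l frag_cmul_diff_distrib2 flip: sum_subtractf)
  qed (simp_all add: boundary_def frag_extend_diff)
qed

text \<open>The homotopy formula \<delta> h + h \<delta> = 1. The face opposite the apex gives
  \<open>c\<close>; the other faces come from faces of the base with index raised by one, hence with
  opposite sign. The augmentation makes the formula valid on the empty tuple too.\<close>

lemma simplicial_boundary_cone:
  assumes "Poly_Mapping.keys c \<subseteq> {xs. set xs \<subseteq> cyc m}"
  shows "simplicial_boundary m (cone m a c) = c - cone m a (simplicial_boundary m c)"
proof (rule frag_additive_eqI[OF assms])
  fix xs assume xs: "xs \<in> {xs. set xs \<subseteq> cyc m}"
  have "simplicial_boundary m (cone m a (frag_of xs)) =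
      (\<Sum>i = Suc 0..Suc (length xs). frag_cmul ((-1) ^ (i - 1)) (frag_of (face_r m i (a # shift m xs))))"
    by (simp add: simplicial_boundary_def del: sum.cl_ivl_Suc)
  also have "\<dots> = frag_of xs + (\<Sum>i = Suc (Suc 0)..Suc (length xs).
       frag_cmul ((-1) ^ (i - 1)) (frag_of (face_r m i (a # shift m xs))))"
    using face_r_Cons_shift(1)[of xs m a] xs by (subst sum.atLeast_Suc_atMost) auto
  also have "(\<Sum>i = Suc (Suc 0)..Suc (length xs).
       frag_cmul ((-1) ^ (i - 1)) (frag_of (face_r m i (a # shift m xs)))) =
     (\<Sum>i = Suc 0..length xs. frag_cmul ((-1) ^ i) (frag_of (face_r m (Suc i) (a # shift m xs))))"
    by (subst sum.shift_bounds_cl_Suc_ivl) simp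
  also have "\<dots> = - (\<Sum>i = Suc 0..length xs.
       frag_cmul ((-1) ^ (i - 1)) (frag_of (a # shift m (face_r m i xs))))"
    unfolding sum_negf[symmetric]
  proof (rule sum.cong)
    fix i assume i: "i \<in> {Suc 0..length xs}"
    then have "(-1::int) ^ i = - ((-1) ^ (i - 1))"
      by (cases i) auto
    then show "frag_cmul ((-1) ^ i) (frag_of (face_r m (Suc i) (a # shift m xs))) =
        - frag_cmul ((-1) ^ (i - 1)) (frag_of (a # shift m (face_r m i xs)))"
      using i xs face_r_Cons_shift(2)[of xs m i a] by simp
  qed simp
  also have "(\<Sum>i = Suc 0..length xs. frag_cmul ((-1) ^ (i - 1)) (frag_of (a # shift m (face_r m i xs))))
      = cone m a (simplicial_boundary m (frag_of xs))"
    by (simp add: cone_def simplicial_boundary_def frag_extend_sum frag_extend_cmul)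
  finally show "simplicial_boundary m (cone m a (frag_of xs)) =
      frag_of xs - cone m a (simplicial_boundary m (frag_of xs))"
    by simp
qed simp_all

text \<open>Adding 1 undoes the shift on residues, so \<open>a # xs\<close> is the cone with apex
  \<open>a\<close> over \<open>ys\<close>. This allows inductions on the length along cones instead
  of computations with pairs of faces.\<close>

lemma cone_vertex:
  assumes "set (a # xs) \<subseteq> cyc m"
  obtains ys where "set ys \<subseteq> cyc m" "length ys = length xs" "xs = shift m ys"
proof
  let ?ys = "map (\<lambda>x. (x + 1) mod int m) xs"
  show "set ?ys \<subseteq> cyc m" "length ?ys = length xs"
    using assms by (auto simp: cyc_def)
  show "xs = shift m ?ys"
    using assms by (auto simp: shift_def mod_simps cyc_def intro!: map_idI[symmetric])
qed

lemma simplicial_boundary_Nil [simp]: "simplicial_boundary m (frag_of []) = 0"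
  by (simp add: simplicial_boundary_def)

lemma simplicial_boundary_0 [simp]: "simplicial_boundary m 0 = 0"
  by (simp add: simplicial_boundary_def)

lemma cone_0 [simp]: "cone m a 0 = 0"
  by (simp add: cone_def)

lemma shift_chain_0 [simp]: "shift_chain m 0 = 0"
  by (simp add: shift_chain_def)

lemma set_face_r: "set xs \<subseteq> cyc m \<Longrightarrow> set (face_r m i xs) \<subseteq> cyc m"
  by (cases "m = 0") (auto simp: face_r_def cyc_def dest!: in_set_takeD in_set_dropD)

lemma length_face_r: "i \<ge> 1 \<Longrightarrow> i \<le> length xs \<Longrightarrow> length (face_r m i xs) = length xs - 1"
  by (simp add: face_r_def)

lemma keys_simplicial_boundary:
  assumes "Poly_Mapping.keys c \<subseteq> {xs. set xs \<subseteq> cyc m \<and> length xs = Suc n}"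
  shows "Poly_Mapping.keys (simplicial_boundary m c) \<subseteq> {xs. set xs \<subseteq> cyc m \<and> length xs = n}"
proof -
  have "Poly_Mapping.keys (\<Sum>i = 1..length xs. frag_cmul ((-1) ^ (i - 1)) (frag_of (face_r m i xs)))
      \<subseteq> {xs. set xs \<subseteq> cyc m \<and> length xs = n}" if "xs \<in> Poly_Mapping.keys c" for xs
  proof -
    have xs: "set xs \<subseteq> cyc m" "length xs = Suc n" using that assms by auto
    then show ?thesis
      using set_face_r[OF xs(1), unfolded subset_iff]
      by (intro order_trans[OF keys_sum] UN_least) (auto simp: length_face_r split: if_splits)
  qed
  then show ?thesis
    unfolding simplicial_boundary_def by (intro order_trans[OF keys_frag_extend]) blast
qed

lemma simplicial_boundary_keys_cyc:
  assumes "Poly_Mapping.keys c \<subseteq> {xs. set xs \<subseteq> cyc m}"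
  shows "Poly_Mapping.keys (simplicial_boundary m c) \<subseteq> {xs. set xs \<subseteq> cyc m}"
  unfolding simplicial_boundary_def using assms set_face_r
  by (intro order_trans[OF keys_frag_extend] UN_least order_trans[OF keys_sum]) (fastforce split: if_splits)

text \<open>Every nonempty tuple is a cone, and \<open>\<delta> h + h \<delta> = 1\<close> gives \<open>\<delta> \<delta> h = h \<delta> \<delta>\<close>.\<close>

lemma simplicial_boundary_simplicial_boundary:
  assumes "Poly_Mapping.keys c \<subseteq> {xs. set xs \<subseteq> cyc m}"
  shows "simplicial_boundary m (simplicial_boundary m c) = 0"
proof -
  have basis: "simplicial_boundary m (simplicial_boundary m (frag_of xs)) = 0"
    if "set xs \<subseteq> cyc m" for xs
    using that
  proof (induction "length xs" arbitrary: xs)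
    case (Suc n)
    then obtain a zs where zs: "xs = a # zs" by (cases xs) auto
    then obtain ys where ys: "set ys \<subseteq> cyc m" "length ys = n" "xs = a # shift m ys"
      using cone_vertex[of a zs m] Suc.prems Suc.hyps(2) by auto
    have "Poly_Mapping.keys (simplicial_boundary m (frag_of ys)) \<subseteq> {xs. set xs \<subseteq> cyc m}"
      using simplicial_boundary_keys_cyc[of "frag_of ys" m] ys by simp
    moreover have "simplicial_boundary m (simplicial_boundary m (frag_of ys)) = 0"
      using Suc.hyps(1) ys by simp
    ultimately show ?case
      using simplicial_boundary_cone[of "frag_of ys" m a] ys
        simplicial_boundary_cone[of "simplicial_boundary m (frag_of ys)" m a]
      by simp
  qed simp
  show ?thesis
    by (rule frag_additive_eqI[OF assms, where g = "\<lambda>_. 0"]) (simp_all add: basis)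
qed

section \<open>Difference lists and degenerate tuples\<close>

fun diffs :: "nat \<Rightarrow> int list \<Rightarrow> int list" where
  "diffs m (x # y # xs) = (x - y) mod int m # diffs m (y # xs)"
| "diffs m _ = []"

text \<open>Writing \<open>1 mod int m\<close> covers m = 1, where the value is 0 and every tuple of
  length at least 2 is degenerate. Phrased through differences, the condition is visibly invariant
  under the shift.\<close>

definition degenerate :: "nat \<Rightarrow> int list set" where
  "degenerate m = {xs. 1 mod int m \<in> set (diffs m xs)}"

lemma diffs_shift [simp]: "diffs m (shift m xs) = diffs m xs"
  by (induction m xs rule: diffs.induct) (simp_all add: shift_def mod_simps)

lemma length_diffs [simp]: "length (diffs m xs) = length xs - 1"
  by (induction m xs rule: diffs.induct) simp_all

lemma nth_diffs: "Suc i < length xs \<Longrightarrow> diffs m xs ! i = (xs ! i - xs ! Suc i) mod int m"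
  by (induction m xs arbitrary: i rule: diffs.induct) (auto simp: nth_Cons split: nat.split)

lemma shift_degenerate: "xs \<in> degenerate m \<Longrightarrow> shift m xs \<in> degenerate m"
  by (simp add: degenerate_def)

lemma Cons_degenerate: "xs \<in> degenerate m \<Longrightarrow> a # shift m xs \<in> degenerate m"
  using diffs_shift[of m xs] by (cases "shift m xs") (auto simp: degenerate_def)

text \<open>For residues a and b, each component of the fixed point equation of \<open>cyc_R\<close>
  says that m divides a - b - 1, which is a condition on a single consecutive difference.\<close>

lemma degenerate_tuples_eq: "degenerate_tuples m n = tuples m n \<inter> degenerate m"
proof -
  have fixed: "cyc_R m (a, b) = (a, b) \<longleftrightarrow> (a - b) mod int m = 1 mod int m"
    if "a \<in> cyc m" "b \<in> cyc m" for a b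
  proof -
    have ab: "a = a mod int m" "b = b mod int m" using that by (auto simp: cyc_def)
    have "(b + 1) mod int m = a \<longleftrightarrow> int m dvd (b + 1) - a"
      by (subst ab(1)) (rule mod_eq_dvd_iff)
    moreover have "(a - 1) mod int m = b \<longleftrightarrow> int m dvd (a - 1) - b"
      by (subst ab(2)) (rule mod_eq_dvd_iff)
    moreover have "(a - b) mod int m = 1 mod int m \<longleftrightarrow> int m dvd (a - b) - 1"
      by (rule mod_eq_dvd_iff)
    moreover have "(a - 1) - b = (a - b) - 1" "(b + 1) - a = - ((a - b) - 1)" by simp_all
    ultimately have "(b + 1) mod int m = a \<longleftrightarrow> (a - b) mod int m = 1 mod int m"
         "(a - 1) mod int m = b \<longleftrightarrow> (a - b) mod int m = 1 mod int m"
      by (simp_all only: dvd_minus_iff)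
    then show ?thesis by (auto simp: cyc_R_def)
  qed
  have "(\<exists>i\<in>{1..<n}. cyc_R m (xs ! (i - 1), xs ! i) = (xs ! (i - 1), xs ! i)) \<longleftrightarrow>
      1 mod int m \<in> set (diffs m xs)" if "xs \<in> tuples m n" for xs
  proof -
    have xs: "length xs = n" "n \<ge> 1" "\<And>i. i < n \<Longrightarrow> xs ! i \<in> cyc m"
      using that by (auto simp: tuples_def)
    have "(\<exists>i\<in>{1..<n}. cyc_R m (xs ! (i - 1), xs ! i) = (xs ! (i - 1), xs ! i)) \<longleftrightarrow>
       (\<exists>i<n-1. cyc_R m (xs ! i, xs ! Suc i) = (xs ! i, xs ! Suc i))"
    proof -
      have "{1..<n} = Suc ` {..<n - 1}"
        using xs(2) by (simp add: image_Suc_lessThan flip: atLeast0LessThan)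
      then show ?thesis by (simp only: bex_simps) auto
    qed
    also have "\<dots> \<longleftrightarrow> (\<exists>i<n-1. diffs m xs ! i = 1 mod int m)"
    proof -
      have "cyc_R m (xs ! i, xs ! Suc i) = (xs ! i, xs ! Suc i) \<longleftrightarrow> diffs m xs ! i = 1 mod int m"
        if "i < n - 1" for i
      proof -
        from that have i: "i < n" "Suc i < n" by auto
        then show ?thesis
          using xs(1) by (simp add: nth_diffs fixed[OF xs(3)[OF i(1)] xs(3)[OF i(2)]] del: One_nat_def)
      qed
      then show ?thesis by blast
    qed
    finally show ?thesis using xs by (auto simp: in_set_conv_nth)
  qed
  then show ?thesis by (auto simp: degenerate_tuples_def degenerate_def)
qed

section \<open>Orbit sums\<close>

text \<open>Induction on the length along cones: either the base is degenerate, or the degenerate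
  pair consists of the apex and the first vertex of the base. In the second case these two vertices
  coincide in the coordinates y_i, and the faces omitting one of them cancel.\<close>

lemma simplicial_boundary_degenerate:
  assumes "Poly_Mapping.keys c \<subseteq> {xs. set xs \<subseteq> cyc m} \<inter> degenerate m"
  shows "Poly_Mapping.keys (simplicial_boundary m c) \<subseteq> degenerate m"
proof -
  have basis: "Poly_Mapping.keys (simplicial_boundary m (frag_of xs)) \<subseteq> degenerate m"
    if "set xs \<subseteq> cyc m" "xs \<in> degenerate m" for xs
    using that
  proof (induction "length xs" arbitrary: xs)
    case 0
    then show ?case by (simp add: degenerate_def)
  next
    case (Suc n)
    then obtain a xs' where "xs = a # xs'" by (cases xs) auto
    then obtain ys where ys: "set ys \<subseteq> cyc m" "length ys = n" "xs = a # shift m ys"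
      using cone_vertex[of a xs' m] Suc.prems Suc.hyps(2) by auto
    have d_xs: "simplicial_boundary m (frag_of xs) =
        frag_of ys - cone m a (simplicial_boundary m (frag_of ys))"
      using simplicial_boundary_cone[of "frag_of ys" m a] ys by simp
    show ?case
    proof (cases "ys \<in> degenerate m")
      case True
      then have "Poly_Mapping.keys (cone m a (simplicial_boundary m (frag_of ys))) \<subseteq> degenerate m"
        using Suc.hyps(1)[of ys] ys keys_cone[of m a "simplicial_boundary m (frag_of ys)"]
        by (auto intro!: Cons_degenerate)
      then show ?thesis
        unfolding d_xs using True by (intro order_trans[OF keys_diff]) auto
    next
      case False
      then obtain b ys' where b: "ys = b # ys'"
        using Suc.prems ys by (cases ys) (auto simp: degenerate_def shift_def)
      then obtain zs where zs: "set zs \<subseteq> cyc m" "ys = b # shift m zs"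
        using cone_vertex[of b ys' m] ys by auto
      \<comment> \<open>The difference 1 modulo \<open>m\<close> does not occur in
        \<open>ys\<close>, so it is the one between \<open>a\<close> and the shifted
        \<open>b\<close>. This forces \<open>a = b\<close>, and \<open>xs\<close> is a double cone
        with apex \<open>a\<close> over \<open>zs\<close>.\<close>
      have "(a - (b - 1) mod int m) mod int m = 1 mod int m"
        using Suc.prems(2) False diffs_shift[of m ys]
        by (auto simp: degenerate_def ys(3) b shift_def)
      then have "int m dvd a - b"
        by (simp add: mod_eq_dvd_iff mod_simps algebra_simps)
      moreover have "a \<in> cyc m" "b \<in> cyc m"
        using Suc.prems(1) ys b by auto
      ultimately have "a = b"
        by (auto simp: cyc_def mod_eq_dvd_iff[symmetric])
      define e where "e = simplicial_boundary m (frag_of zs)"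
      have "simplicial_boundary m (frag_of ys) = frag_of zs - cone m a e"
        using simplicial_boundary_cone[of "frag_of zs" m a] zs \<open>a = b\<close> by (simp add: e_def)
      \<comment> \<open>The terms \<open>cone m a (frag_of zs)\<close> cancel. Tuples in a double
        cone start with \<open>a\<close> and a - 1 modulo \<open>m\<close>, a degenerate
        pair.\<close>
      then have "simplicial_boundary m (frag_of xs) = cone m a (cone m a e)"
        using d_xs zs \<open>a = b\<close> by simp
      also have "Poly_Mapping.keys \<dots> \<subseteq> degenerate m"
        using keys_cone[of m a "cone m a e"] keys_cone[of m a e]
        by (fastforce simp: degenerate_def shift_def mod_simps)
      finally show ?thesis .
    qed
  qed
  show ?thesis
    unfolding simplicial_boundary_def
    by (intro order_trans[OF keys_frag_extend] UN_least)
       (use assms basis in \<open>fastforce simp: simplicial_boundary_def\<close>)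
qed

section \<open>The norm N = 1 + T + ... + T^(m-1) and division by T - 1\<close>

definition orbit_sum :: "nat \<Rightarrow> (int list \<Rightarrow>\<^sub>0 int) \<Rightarrow> (int list \<Rightarrow>\<^sub>0 int)" where
  "orbit_sum m c = (\<Sum>j<m. (shift_chain m ^^ j) c)"

text \<open>This is the polynomial Q in T with (T - 1) Q = m - N, obtained from T^j - 1 = (T - 1)(1
  + ... + T^(j-1)). On chains killed by N it is an integral substitute for m times the inverse of T
  - 1.\<close>

definition shift_quotient :: "nat \<Rightarrow> (int list \<Rightarrow>\<^sub>0 int) \<Rightarrow> (int list \<Rightarrow>\<^sub>0 int)" where
  "shift_quotient m c = - (\<Sum>j<m. \<Sum>i<j. (shift_chain m ^^ i) c)"

lemma shift_chain_sum: "shift_chain m (\<Sum>i\<in>I. f i) = (\<Sum>i\<in>I. shift_chain m (f i))"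
  by (cases "finite I") (simp_all add: shift_chain_def frag_extend_sum)

lemma simplicial_boundary_sum:
  "simplicial_boundary m (\<Sum>i\<in>I. f i) = (\<Sum>i\<in>I. simplicial_boundary m (f i))"
  by (cases "finite I") (simp_all add: simplicial_boundary_def frag_extend_sum)

lemma shift_chain_minus: "shift_chain m (- c) = - shift_chain m c"
  by (simp add: shift_chain_def frag_extend_minus)

lemma simplicial_boundary_minus: "simplicial_boundary m (- c) = - simplicial_boundary m c"
  by (simp add: simplicial_boundary_def frag_extend_minus)

lemma shift_chain_funpow_0 [simp]: "(shift_chain m ^^ j) 0 = 0"
  by (induction j) simp_all

lemma shift_chain_funpow_diff:
  "(shift_chain m ^^ j) (x - y) = (shift_chain m ^^ j) x - (shift_chain m ^^ j) y"
  by (induction j) simp_all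

lemma shift_chain_funpow_minus: "(shift_chain m ^^ j) (- x) = - (shift_chain m ^^ j) x"
  by (induction j) (simp_all add: shift_chain_minus)

lemma shift_chain_funpow_sum:
  "(shift_chain m ^^ j) (\<Sum>i\<in>I. f i) = (\<Sum>i\<in>I. (shift_chain m ^^ j) (f i))"
  by (induction j) (simp_all add: shift_chain_sum)

lemma shift_chain_funpow_frag_of: "(shift_chain m ^^ j) (frag_of xs) = frag_of ((shift m ^^ j) xs)"
  by (induction j) simp_all

lemma simplicial_boundary_shift_chain_funpow:
  "simplicial_boundary m ((shift_chain m ^^ j) c) = (shift_chain m ^^ j) (simplicial_boundary m c)"
  by (induction j) (simp_all flip: shift_chain_simplicial_boundary)

lemma keys_shift_chain_funpow:
  assumes "Poly_Mapping.keys c \<subseteq> S" and "\<And>xs. xs \<in> S \<Longrightarrow> shift m xs \<in> S"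
  shows "Poly_Mapping.keys ((shift_chain m ^^ j) c) \<subseteq> S"
proof (induction j)
  case (Suc j)
  then show ?case
    using keys_shift_chain[of m "(shift_chain m ^^ j) c"] assms(2) by auto
qed (simp add: assms)

lemma shift_chain_partial_sum:
  "shift_chain m (\<Sum>i<j. (shift_chain m ^^ i) c) - (\<Sum>i<j. (shift_chain m ^^ i) c) =
     (shift_chain m ^^ j) c - c"
proof (induction j)
  case (Suc j)
  have "shift_chain m (x + y) = shift_chain m x + shift_chain m y" for x y
    by (simp add: shift_chain_def frag_extend_add)
  then show ?case using Suc by (simp add: algebra_simps)
qed simp

lemma sum_constant_frag: "(\<Sum>j<n. c) = frag_cmul (int n) c"
  by (induction n) (simp_all add: frag_cmul_distrib)

lemma shift_chain_shift_quotient: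
  "shift_chain m (shift_quotient m c) - shift_quotient m c = frag_cmul (int m) c - orbit_sum m c"
proof -
  have "shift_chain m (shift_quotient m c) - shift_quotient m c =
    - (\<Sum>j<m. shift_chain m (\<Sum>i<j. (shift_chain m ^^ i) c) - (\<Sum>i<j. (shift_chain m ^^ i) c))"
    unfolding shift_quotient_def shift_chain_minus shift_chain_sum sum_subtractf by simp
  also have "\<dots> = (\<Sum>j<m. c) - orbit_sum m c"
    unfolding shift_chain_partial_sum by (simp add: sum_subtractf orbit_sum_def)
  finally show ?thesis by (simp add: sum_constant_frag)
qed

text \<open>On chains of residue tuples T^m = 1, so T - 1 telescopes the geometric sum of length
  \<open>m\<close> to 0.\<close>

lemma shift_chain_orbit_sum:
  assumes "Poly_Mapping.keys c \<subseteq> {xs. set xs \<subseteq> cyc m}"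
  shows "shift_chain m (orbit_sum m c) = orbit_sum m c"
proof -
  have "(shift_chain m ^^ m) c = c"
    by (rule frag_additive_eqI[OF assms])
      (simp_all add: shift_chain_funpow_diff shift_chain_funpow_frag_of shift_funpow_order)
  then show ?thesis
    using shift_chain_partial_sum[where m = m and j = m and c = c] by (simp add: orbit_sum_def)
qed

lemma orbit_sum_diff [simp]: "orbit_sum m (x - y) = orbit_sum m x - orbit_sum m y"
  by (simp add: orbit_sum_def shift_chain_funpow_diff sum_subtractf)

lemma orbit_sum_shift_chain: "orbit_sum m (shift_chain m c) = shift_chain m (orbit_sum m c)"
  by (simp add: orbit_sum_def shift_chain_sum funpow_swap1)

lemma orbit_sum_shift_quotient: "orbit_sum m (shift_quotient m c) = shift_quotient m (orbit_sum m c)"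
proof -
  have "(shift_chain m ^^ i) ((shift_chain m ^^ j) x) = (shift_chain m ^^ j) ((shift_chain m ^^ i) x)" for i j x
    by (metis add.commute comp_apply funpow_add)
  then show ?thesis
    by (simp add: orbit_sum_def shift_quotient_def shift_chain_funpow_minus shift_chain_funpow_sum sum_negf)
      (subst sum.swap, rule sum.cong[OF refl], subst sum.swap, simp)
qed

lemma simplicial_boundary_orbit_sum:
  "simplicial_boundary m (orbit_sum m c) = orbit_sum m (simplicial_boundary m c)"
  by (simp add: orbit_sum_def simplicial_boundary_sum simplicial_boundary_shift_chain_funpow)

lemma simplicial_boundary_shift_quotient:
  "simplicial_boundary m (shift_quotient m c) = shift_quotient m (simplicial_boundary m c)"
  by (simp add: shift_quotient_def simplicial_boundary_sum simplicial_boundary_minus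
      simplicial_boundary_shift_chain_funpow)

lemma shift_quotient_diff: "shift_quotient m (x - y) = shift_quotient m x - shift_quotient m y"
  by (simp add: shift_quotient_def shift_chain_funpow_diff sum_subtractf)

lemma shift_quotient_shift_chain:
  "shift_quotient m (shift_chain m c) = shift_chain m (shift_quotient m c)"
  by (simp add: shift_quotient_def shift_chain_sum shift_chain_minus funpow_swap1)

lemma shift_quotient_0 [simp]: "shift_quotient m 0 = 0"
  by (simp add: shift_quotient_def)

lemma keys_sum_subset: "(\<And>i. i \<in> I \<Longrightarrow> Poly_Mapping.keys (f i) \<subseteq> S) \<Longrightarrow> Poly_Mapping.keys (sum f I) \<subseteq> S"
  using keys_sum[of f I] by blast

lemma keys_shift_quotient:
  assumes "Poly_Mapping.keys c \<subseteq> S" and "\<And>xs. xs \<in> S \<Longrightarrow> shift m xs \<in> S"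
  shows "Poly_Mapping.keys (shift_quotient m c) \<subseteq> S"
  unfolding shift_quotient_def keys_minus
  by (intro keys_sum_subset keys_shift_chain_funpow assms)

lemma keys_orbit_sum:
  assumes "Poly_Mapping.keys c \<subseteq> S" and "\<And>xs. xs \<in> S \<Longrightarrow> shift m xs \<in> S"
  shows "Poly_Mapping.keys (orbit_sum m c) \<subseteq> S"
  unfolding orbit_sum_def by (intro keys_sum_subset keys_shift_chain_funpow assms)

text \<open>The case \<open>K = {}\<close> treats cycles of a subcomplex, and \<open>K\<close> the degenerate tuples those of the
  quotient. The chain \<open>w\<close> satisfies \<open>(T - 1) w = m z\<close>. Modulo \<open>K\<close>, \<open>u = \<delta> w\<close> is shift-invariant, so
  \<open>m u\<close> is its orbit sum, which is 0; hence \<open>w = \<delta> h w\<close> and \<open>m z = (T - 1) \<delta> h w\<close>.\<close>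

lemma relative_cycle_torsion:
  assumes "m > 0"
    and z: "Poly_Mapping.keys z \<subseteq> {xs. set xs \<subseteq> cyc m}" "orbit_sum m z = 0"
    and K: "\<And>xs. xs \<in> K \<Longrightarrow> shift m xs \<in> K" "\<And>xs. xs \<in> K \<Longrightarrow> 0 # shift m xs \<in> K"
    and cycle: "Poly_Mapping.keys (shift_chain m (simplicial_boundary m z) - simplicial_boundary m z) \<subseteq> K"
  defines "b \<equiv> simplicial_boundary m (cone m 0 (shift_quotient m z))"
  shows "Poly_Mapping.keys (frag_cmul (int m) z - (shift_chain m b - b)) \<subseteq> K"
proof -
  define w where "w = shift_quotient m z"
  define u where "u = simplicial_boundary m w"
  have w: "Poly_Mapping.keys w \<subseteq> {xs. set xs \<subseteq> cyc m}"
    unfolding w_def using set_shift[OF \<open>m > 0\<close>] by (intro keys_shift_quotient[OF z(1)]) auto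
  have "shift_chain m u - u =
      shift_quotient m (shift_chain m (simplicial_boundary m z) - simplicial_boundary m z)"
    by (simp add: u_def w_def simplicial_boundary_shift_quotient shift_quotient_diff
        shift_quotient_shift_chain)
  then have Tu: "Poly_Mapping.keys (shift_chain m u - u) \<subseteq> K"
    using keys_shift_quotient[OF cycle K(1)] by simp
  have "orbit_sum m u = 0"
    by (simp add: u_def w_def orbit_sum_shift_quotient z(2) flip: simplicial_boundary_orbit_sum)
  moreover have "Poly_Mapping.keys (shift_chain m (shift_quotient m u) - shift_quotient m u) \<subseteq> K"
    using keys_shift_quotient[OF Tu K(1)] by (simp add: shift_quotient_diff shift_quotient_shift_chain)
  \<comment> \<open>Since N u = 0, the identity (T - 1) Q u = m u - N u exhibits m u as supported in
    \<open>K\<close>; multiplication by \<open>m > 0\<close> does not change the support.\<close>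
  ultimately have u: "Poly_Mapping.keys u \<subseteq> K"
    using \<open>m > 0\<close> by (auto simp: shift_chain_shift_quotient)
  have "Poly_Mapping.keys (cone m 0 u) \<subseteq> K"
    using keys_cone[of m 0 u] u K(2) by auto
  moreover from this have "Poly_Mapping.keys (shift_chain m (cone m 0 u)) \<subseteq> K"
    using keys_shift_chain[of m "cone m 0 u"] K(1) by auto
  moreover have "b = w - cone m 0 u"
    using simplicial_boundary_cone[OF w] by (simp add: b_def u_def w_def)
  then have "shift_chain m b - b =
      (shift_chain m w - w) - (shift_chain m (cone m 0 u) - cone m 0 u)"
    by simp
  then have "frag_cmul (int m) z - (shift_chain m b - b) = shift_chain m (cone m 0 u) - cone m 0 u"
    unfolding w_def shift_chain_shift_quotient z(2) by simp
  ultimately show ?thesis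
    using keys_diff[of "shift_chain m (cone m 0 u)" "cone m 0 u"] by auto
qed

section \<open>Projection of chains onto the free group on orbits\<close>

definition orbit_map :: "nat \<Rightarrow> (int list \<Rightarrow>\<^sub>0 int) \<Rightarrow> (int list \<Rightarrow>\<^sub>0 int)" where
  "orbit_map m = frag_extend (frag_of \<circ> diffs m)"

lemma orbit_map_diff: "orbit_map m (x - y) = orbit_map m x - orbit_map m y"
  by (simp add: orbit_map_def frag_extend_diff)

lemma orbit_map_add: "orbit_map m (x + y) = orbit_map m x + orbit_map m y"
  by (simp add: orbit_map_def frag_extend_add)

lemma orbit_map_frag_of: "orbit_map m (frag_of xs) = frag_of (diffs m xs)"
  by (simp add: orbit_map_def)

lemma keys_orbit_map: "Poly_Mapping.keys (orbit_map m c) \<subseteq> diffs m ` Poly_Mapping.keys c"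
  using keys_frag_extend[of "frag_of \<circ> diffs m" c] by (auto simp: orbit_map_def)

lemma orbit_map_shift_chain: "orbit_map m (shift_chain m c) = orbit_map m c"
  by (rule frag_additive_eqI[of c UNIV]) (simp_all add: orbit_map_diff orbit_map_frag_of)

text \<open>All \<open>m\<close> translates of a tuple lie in one orbit. Orbit sums thereby realise
  the \<open>m\<close>-multiples of basis elements that the rank criterion asks for.\<close>

lemma orbit_map_orbit_sum: "orbit_map m (orbit_sum m c) = frag_cmul (int m) (orbit_map m c)"
proof -
  have "orbit_map m ((shift_chain m ^^ j) c) = orbit_map m c" for j
    by (induction j) (simp_all add: orbit_map_shift_chain)
  then have "(\<Sum>j<m. orbit_map m ((shift_chain m ^^ j) c)) = frag_cmul (int m) (orbit_map m c)"
    by (simp add: sum_constant_frag)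
  then show ?thesis
    by (simp add: orbit_sum_def orbit_map_def frag_extend_sum)
qed

text \<open>Equal consecutive differences make x_i - y_i constant modulo \<open>m\<close>; this
  constant, read off from the first entries, is the amount of the shift.\<close>

lemma diffs_eq_imp_shift:
  assumes "set xs \<subseteq> cyc m" "set ys \<subseteq> cyc m" "length xs = length ys" "diffs m xs = diffs m ys"
  shows "\<exists>k. ys = (shift m ^^ k) xs"
proof (cases xs)
  case Nil
  then show ?thesis using assms by (auto intro: exI[of _ 0])
next
  case (Cons x xs')
  then obtain y ys' where y: "ys = y # ys'"
    using assms(3) by (cases ys) auto
  have "ys = map (\<lambda>t. (t - (x - y)) mod int m) xs"
    using assms unfolding Cons y
  proof (induction xs' ys' arbitrary: x y rule: list_induct2')
    case (4 x' xs' y' ys')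
    have "(x - x') mod int m = (y - y') mod int m" using 4 by simp
    then have "(x' - (x - y)) mod int m = y' mod int m"
      by (simp add: mod_eq_dvd_iff algebra_simps) (metis add.commute diff_add_eq diff_diff_eq2 dvd_diff_commute)
    moreover have "y' # ys' = map (\<lambda>t. (t - (x' - y')) mod int m) (x' # xs')"
      by (rule 4(1)) (use 4 in auto)
    moreover have "(t - (x' - y')) mod int m = (t - (x - y)) mod int m" for t
      using \<open>(x - x') mod int m = (y - y') mod int m\<close>
      by (simp add: mod_eq_dvd_iff algebra_simps)
    ultimately show ?case
      using 4(3) by (auto simp: cyc_def)
  qed (auto simp: cyc_def)
  \<comment> \<open>Iterating the shift takes a natural number, so x - y is replaced by its
    residue.\<close>
  moreover have "(t - int (nat ((x - y) mod int m))) mod int m = (t - (x - y)) mod int m" for t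
    using assms(1) by (auto simp: Cons cyc_def mod_simps)
  ultimately have "ys = (shift m ^^ nat ((x - y) mod int m)) xs"
    using assms(1) by (simp add: shift_funpow)
  then show ?thesis ..
qed

text \<open>The orbit sum of a tuple depends only on its orbit, so N factors through
  \<open>orbit_map\<close>. The factor \<open>f\<close> is defined by a chosen representative
  \<open>r l\<close> of each difference list.\<close>

lemma orbit_sum_eq_0:
  assumes z: "Poly_Mapping.keys z \<subseteq> tuples m n" and "orbit_map m z = 0"
  shows "orbit_sum m z = 0"
proof -
  define r where "r l = (SOME xs. xs \<in> tuples m n \<and> diffs m xs = l)" for l
  define f where "f = frag_extend (\<lambda>l. orbit_sum m (frag_of (r l)))"
  have "f (orbit_map m z) = orbit_sum m z"
  proof (rule frag_additive_eqI[OF z])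
    fix xs assume xs: "xs \<in> tuples m n"
    then have "\<exists>ys. ys \<in> tuples m n \<and> diffs m ys = diffs m xs" by blast
    from someI_ex[OF this] have "r (diffs m xs) \<in> tuples m n \<and> diffs m (r (diffs m xs)) = diffs m xs"
      by (simp add: r_def)
    then obtain k where "r (diffs m xs) = (shift m ^^ k) xs"
      using xs diffs_eq_imp_shift[of xs m "r (diffs m xs)"] by (auto simp: tuples_def)
    moreover have "orbit_sum m (frag_of ((shift m ^^ k) xs)) = orbit_sum m (frag_of xs)"
    proof (induction k)
      case (Suc k)
      then show ?case
        using orbit_sum_shift_chain[of m "frag_of ((shift m ^^ k) xs)"]
          shift_chain_orbit_sum[of "frag_of xs" m] xs by (simp add: tuples_def)
    qed simp
    ultimately show "f (orbit_map m (frag_of xs)) = orbit_sum m (frag_of xs)"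
      by (simp add: f_def orbit_map_frag_of)
  qed (simp_all add: f_def orbit_map_diff frag_extend_diff)
  then show ?thesis using assms(2) by (simp add: f_def)
qed

section \<open>Counting difference lists\<close>

lemma diffs_surj:
  assumes "m > 0" "set l \<subseteq> cyc m"
  shows "\<exists>xs \<in> tuples m (Suc (length l)). diffs m xs = l"
  using assms(2)
proof (induction l)
  case Nil
  then show ?case using \<open>m > 0\<close> by (intro bexI[of _ "[0]"]) (auto simp: tuples_def cyc_def)
next
  case (Cons d l)
  then obtain xs where xs: "xs \<in> tuples m (Suc (length l))" "diffs m xs = l" by auto
  then obtain y ys where y: "xs = y # ys" by (cases xs) (auto simp: tuples_def)
  \<comment> \<open>The prescribed difference \<open>d\<close> to the old first entry
    \<open>y\<close> dictates the new first entry; the recursion starts from the tuple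
    \<open>[0]\<close>.\<close>
  have "((y + d) mod int m - y) mod int m = d"
    using Cons.prems by (simp add: mod_simps cyc_def)
  then show ?case
    using xs \<open>m > 0\<close> by (intro bexI[of _ "(y + d) mod int m # xs"]) (auto simp: y tuples_def cyc_def)
qed

lemma set_diffs: "m > 0 \<Longrightarrow> set (diffs m xs) \<subseteq> cyc m"
  by (induction m xs rule: diffs.induct) (auto simp: cyc_def)

lemma diffs_image:
  assumes "m > 0" "n \<ge> 1"
  shows "diffs m ` tuples m n = {l. set l \<subseteq> cyc m \<and> length l = n - 1}"
    and "diffs m ` (tuples m n \<inter> degenerate m) =
      {l. set l \<subseteq> cyc m \<and> length l = n - 1} - {l. set l \<subseteq> cyc m - {1 mod int m} \<and> length l = n - 1}"
    and "diffs m ` (tuples m n - degenerate m) = {l. set l \<subseteq> cyc m - {1 mod int m} \<and> length l = n - 1}"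
proof -
  show *: "diffs m ` tuples m n = {l. set l \<subseteq> cyc m \<and> length l = n - 1}"
  proof (intro equalityI subsetI)
    fix l assume "l \<in> {l. set l \<subseteq> cyc m \<and> length l = n - 1}"
    then show "l \<in> diffs m ` tuples m n"
      using diffs_surj[of m l] assms by auto
  qed (use set_diffs[OF assms(1)] in \<open>auto simp: tuples_def\<close>)
  \<comment> \<open>\<open>degenerate m\<close> is a preimage under \<open>diffs m\<close>, so
    taking images commutes with intersecting with it and with removing it.\<close>
  have "diffs m ` (tuples m n \<inter> degenerate m) = diffs m ` tuples m n \<inter> {l. 1 mod int m \<in> set l}"
    "diffs m ` (tuples m n - degenerate m) = diffs m ` tuples m n - {l. 1 mod int m \<in> set l}"
    by (auto simp: degenerate_def)
  then show "diffs m ` (tuples m n \<inter> degenerate m) =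
      {l. set l \<subseteq> cyc m \<and> length l = n - 1} - {l. set l \<subseteq> cyc m - {1 mod int m} \<and> length l = n - 1}"
    and "diffs m ` (tuples m n - degenerate m) = {l. set l \<subseteq> cyc m - {1 mod int m} \<and> length l = n - 1}"
    unfolding * by auto
qed

text \<open>Difference lists are words of length n - 1 over \<open>m\<close> letters, and the
  nondegenerate ones avoid the letter \<open>1 mod int m\<close>. For n = 1 only the empty word
  remains, in agreement with 0^0 = 1.\<close>

lemma card_diffs_image:
  assumes "m > 0" "n \<ge> 1"
  shows "card (diffs m ` tuples m n) = m ^ (n - 1)"
    and "card (diffs m ` (tuples m n \<inter> degenerate m)) = m ^ (n - 1) - (m - 1) ^ (n - 1)"
    and "card (diffs m ` (tuples m n - degenerate m)) = (m - 1) ^ (n - 1)"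
proof -
  have cyc: "finite (cyc m)" "card (cyc m) = m" "1 mod int m \<in> cyc m"
    using assms by (auto simp: cyc_def)
  have "finite {l. set l \<subseteq> cyc m - {1 mod int m} \<and> length l = n - 1}"
    using cyc by (intro finite_lists_length_eq) auto
  moreover have "{l. set l \<subseteq> cyc m - {1 mod int m} \<and> length l = n - 1} \<subseteq>
      {l. set l \<subseteq> cyc m \<and> length l = n - 1}" by auto
  ultimately show "card (diffs m ` tuples m n) = m ^ (n - 1)"
    "card (diffs m ` (tuples m n \<inter> degenerate m)) = m ^ (n - 1) - (m - 1) ^ (n - 1)"
    "card (diffs m ` (tuples m n - degenerate m)) = (m - 1) ^ (n - 1)"
    unfolding diffs_image[OF assms] using cyc
    by (simp_all add: card_lists_length_eq card_Diff_subset)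
qed

section \<open>Rank of the homology of a complex\<close>

text \<open>Since \<open>h\<close> kills boundaries it induces a map \<open>g\<close> on homology.
  By \<open>img\<close> its image contains all \<open>k\<close>-multiples of basis elements, and by
  \<open>ker\<close> its kernel is torsion, so \<open>group_rank_eq_cardI\<close> applies.\<close>

lemma group_rank_homology:
  fixes C :: "nat \<Rightarrow> ('a, 'b) monoid_scheme" and h :: "'a \<Rightarrow> 'i \<Rightarrow>\<^sub>0 int"
  assumes C: "comm_group (C n)" "group (C (n - 1))" "group (C (n + 1))"
    and d: "d n \<in> hom (C n) (C (n - 1))" "d (n + 1) \<in> hom (C (n + 1)) (C n)"
    and dd: "\<And>c. c \<in> carrier (C (n + 1)) \<Longrightarrow> d n (d (n + 1) c) = \<one>\<^bsub>C (n - 1)\<^esub>"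
    and I: "finite I" "h \<in> hom (C n) (free_Abelian_group I)" "k > 0"
    and hd: "\<And>c. c \<in> carrier (C (n + 1)) \<Longrightarrow> h (d (n + 1) c) = 0"
    and img: "\<And>i. i \<in> I \<Longrightarrow>
      \<exists>z\<in>carrier (C n). d n z = \<one>\<^bsub>C (n - 1)\<^esub> \<and> h z = frag_cmul k (frag_of i)"
    and ker: "\<And>z. z \<in> carrier (C n) \<Longrightarrow> d n z = \<one>\<^bsub>C (n - 1)\<^esub> \<Longrightarrow> h z = 0 \<Longrightarrow>
      \<exists>l::nat. l > 0 \<and> z [^]\<^bsub>C n\<^esub> l \<in> d (n + 1) ` carrier (C (n + 1))"
  shows "group_rank (homology C d n) = card I"
proof -
  define Z where "Z = (C n)\<lparr>carrier := kernel (C n) (C (n - 1)) (d n)\<rparr>"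
  define B where "B = d (n + 1) ` carrier (C (n + 1))"
  interpret Cn: comm_group "C n" by (rule C)
  interpret d: group_hom "C n" "C (n - 1)" "d n"
    using C d by (simp add: group_hom_def group_hom_axioms_def Cn.is_group)
  interpret d': group_hom "C (n + 1)" "C n" "d (n + 1)"
    using C d by (simp add: group_hom_def group_hom_axioms_def Cn.is_group)
  have Z_sub: "subgroup (kernel (C n) (C (n - 1)) (d n)) (C n)"
    by (rule d.subgroup_kernel)
  interpret Z: comm_group Z
    unfolding Z_def
    by (rule group.group_comm_groupI[OF Cn.subgroup_imp_group[OF Z_sub]])
      (use subgroup.mem_carrier[OF Z_sub] in \<open>simp add: Cn.m_comm\<close>)
  have Z_carrier: "x \<in> carrier Z \<longleftrightarrow> x \<in> carrier (C n) \<and> d n x = \<one>\<^bsub>C (n - 1)\<^esub>" for x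
    by (auto simp: Z_def kernel_def)
  have "B \<subseteq> carrier Z"
    unfolding B_def by (intro image_subsetI) (simp only: Z_carrier dd d'.hom_closed simp_thms)
  moreover have "subgroup B (C n)"
    unfolding B_def by (rule d'.img_is_subgroup)
  ultimately have B_sub: "subgroup B Z"
    unfolding Z_def using Cn.subgroup_incl[OF _ Z_sub] by simp
  interpret B: normal B Z
    using B_sub by (simp add: Z.normal_iff_subgroup)
  interpret h: group_hom Z "free_Abelian_group I" h
    using I(2) by (auto simp: group_hom_def group_hom_axioms_def Z.is_group hom_def Z_carrier)
      (auto simp: Z_def Pi_iff)
  have "B \<subseteq> kernel Z (free_Abelian_group I) h"
    using \<open>B \<subseteq> carrier Z\<close> hd by (auto simp: kernel_def B_def)
  then obtain g where g: "g \<in> hom (Z Mod B) (free_Abelian_group I)"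
      "\<And>x. x \<in> carrier Z \<Longrightarrow> g (B #>\<^bsub>Z\<^esub> x) = h x"
    using h.FactGroup_universal_kernel[OF B.normal_axioms] by blast
  interpret H: comm_group "Z Mod B"
    by (rule Z.abelian_FactGroup[OF B_sub])
  have "group_rank (Z Mod B) = card I"
  proof (rule H.group_rank_eq_cardI[OF I(1) g(1) I(3)])
    fix i assume "i \<in> I"
    then obtain z where z: "z \<in> carrier Z" "h z = frag_cmul k (frag_of i)"
      using img by (auto simp: Z_carrier)
    then show "frag_cmul k (frag_of i) \<in> g ` carrier (Z Mod B)"
      using g(2)[OF z(1)] by (intro image_eqI[of _ _ "B #>\<^bsub>Z\<^esub> z"]) (auto simp: carrier_FactGroup)
  next
    fix K assume K: "K \<in> carrier (Z Mod B)" "g K = 0"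
    then obtain z where z: "z \<in> carrier Z" "K = B #>\<^bsub>Z\<^esub> z"
      by (auto simp: carrier_FactGroup)
    then obtain l :: nat where l: "l > 0" "z [^]\<^bsub>C n\<^esub> l \<in> B"
      using ker[of z] g(2)[OF z(1)] K(2) by (auto simp: Z_carrier B_def)
    have "z [^]\<^bsub>Z\<^esub> l = z [^]\<^bsub>C n\<^esub> l"
      by (simp add: Z_def nat_pow_def)
    then have "B #>\<^bsub>Z\<^esub> (z [^]\<^bsub>Z\<^esub> l) = B"
      using l(2) by (simp add: B.rcos_const Z.is_group)
    then have "K [^]\<^bsub>Z Mod B\<^esub> l = \<one>\<^bsub>Z Mod B\<^esub>"
      using z by (simp add: B.FactGroup_pow)
    then show "K \<in> torsion_subgroup (Z Mod B)"
      using l K by (auto simp: torsion_subgroup_def)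
  qed
  then show ?thesis by (simp add: homology_def Z_def B_def)
qed

section \<open>The Yang-Baxter boundary and its subcomplexes\<close>

lemma keys_boundary:
  assumes "n \<ge> 1" "m > 0" "Poly_Mapping.keys c \<subseteq> tuples m n"
  shows "Poly_Mapping.keys (boundary m n c) \<subseteq> tuples m (n - 1)"
\<comment> \<open>Degree 1 is separate because \<delta> sends it to multiples of the empty tuple,
  whereas \<open>tuples m 0\<close> is empty.\<close>
proof (cases "n = 1")
  case True
  then show ?thesis by (simp add: boundary_def)
next
  case False
  then obtain k where k: "n = Suc k" "k \<ge> 1" using assms(1) by (cases n) auto
  then have tuples: "tuples m k = {xs. set xs \<subseteq> cyc m \<and> length xs = k}"
    by (auto simp: tuples_def)
  have "Poly_Mapping.keys (simplicial_boundary m c) \<subseteq> tuples m k"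
    unfolding tuples by (rule keys_simplicial_boundary) (use assms k in \<open>auto simp: tuples_def\<close>)
  moreover from this have "Poly_Mapping.keys (shift_chain m (simplicial_boundary m c)) \<subseteq> tuples m k"
    using keys_shift_chain[of m "simplicial_boundary m c"] set_shift[OF assms(2)]
    unfolding tuples by fastforce
  ultimately have "Poly_Mapping.keys (boundary m n c) \<subseteq> tuples m k"
    unfolding boundary_eq[OF assms(1,3)] by (intro order_trans[OF keys_diff]) auto
  then show ?thesis by (simp add: k)
qed

lemma shift_tuples: "m > 0 \<Longrightarrow> xs \<in> tuples m n \<Longrightarrow> shift m xs \<in> tuples m n"
  using set_shift by (auto simp: tuples_def)

lemma boundary_add: "boundary m n (x + y) = boundary m n x + boundary m n y"
  by (simp add: boundary_def frag_extend_add)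

lemma orbit_map_boundary:
  assumes "n \<ge> 1" "Poly_Mapping.keys c \<subseteq> tuples m n"
  shows "orbit_map m (boundary m n c) = 0"
  by (simp add: boundary_eq[OF assms] orbit_map_diff orbit_map_shift_chain)

text \<open>T commutes with \<delta>, so the composite is (T - 1)^2 \<delta> \<delta> = 0.\<close>

lemma boundary_boundary:
  assumes "n \<ge> 1" "m > 0" "Poly_Mapping.keys c \<subseteq> tuples m (n + 1)"
  shows "boundary m n (boundary m (n + 1) c) = 0"
proof -
  have "Poly_Mapping.keys (boundary m (n + 1) c) \<subseteq> tuples m n"
    using keys_boundary[of "n + 1" m c] assms by simp
  moreover have "simplicial_boundary m (simplicial_boundary m c) = 0"
    using assms(3) by (intro simplicial_boundary_simplicial_boundary) (auto simp: tuples_def)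
  ultimately show ?thesis
    using assms by (simp add: boundary_eq flip: shift_chain_simplicial_boundary)
qed

lemma keys_cone_tuples:
  assumes "m > 0" "Poly_Mapping.keys c \<subseteq> tuples m n"
  shows "Poly_Mapping.keys (cone m 0 c) \<subseteq> tuples m (n + 1)"
proof -
  have "0 # shift m xs \<in> tuples m (n + 1)" if "xs \<in> tuples m n" for xs
    using that assms(1) set_shift[OF assms(1), of xs] by (simp add: tuples_def) (simp add: cyc_def)
  then show ?thesis
    using keys_cone[of m 0 c] assms(2) by blast
qed

text \<open>T N = N and T commutes with \<delta>, so (T - 1) \<delta> N = 0.\<close>

lemma boundary_orbit_sum:
  assumes "n \<ge> 1" "m > 0" "Poly_Mapping.keys c \<subseteq> tuples m n"
  shows "boundary m n (orbit_sum m c) = 0"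
proof -
  have "Poly_Mapping.keys (orbit_sum m c) \<subseteq> tuples m n"
    using assms by (intro keys_orbit_sum shift_tuples) auto
  moreover have "shift_chain m (orbit_sum m c) = orbit_sum m c"
    using assms by (intro shift_chain_orbit_sum) (auto simp: tuples_def)
  ultimately show ?thesis
    using assms(1) by (simp add: boundary_eq shift_chain_simplicial_boundary)
qed

lemma finite_tuples: "finite (tuples m n)"
proof (rule finite_subset)
  show "tuples m n \<subseteq> {xs. set xs \<subseteq> cyc m \<and> length xs = n}"
    by (auto simp: tuples_def)
  show "finite {xs. set xs \<subseteq> cyc m \<and> length xs = n}"
    by (rule finite_lists_length_eq) (simp add: cyc_def)
qed

text \<open>Serves the full complex with \<open>K\<close> = \<open>UNIV\<close> and the degenerate
  one with \<open>K\<close> = \<open>degenerate m\<close>. Closure of \<open>K\<close> under the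
  shift, the cone with apex 0 and \<delta> keeps all constructions inside the subcomplex.\<close>

lemma group_rank_subcomplex:
  assumes "m > 0" "n \<ge> 1"
    and K: "\<And>xs. xs \<in> K \<Longrightarrow> shift m xs \<in> K" "\<And>xs. xs \<in> K \<Longrightarrow> 0 # shift m xs \<in> K"
      "\<And>c. Poly_Mapping.keys c \<subseteq> {xs. set xs \<subseteq> cyc m} \<inter> K \<Longrightarrow>
         Poly_Mapping.keys (simplicial_boundary m c) \<subseteq> K"
  shows "group_rank (homology (\<lambda>n. free_Abelian_group (tuples m n \<inter> K)) (boundary m) n) =
    card (diffs m ` (tuples m n \<inter> K))"
proof (rule group_rank_homology[where h = "orbit_map m" and k = "int m"])
  have hom: "boundary m l \<in> hom (free_Abelian_group (tuples m l \<inter> K)) (free_Abelian_group (tuples m (l - 1) \<inter> K))"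
    if "l \<ge> 1" for l
  proof (rule homI)
    fix c assume "c \<in> carrier (free_Abelian_group (tuples m l \<inter> K))"
    then have c: "Poly_Mapping.keys c \<subseteq> tuples m l" "Poly_Mapping.keys c \<subseteq> K" by auto
    then have "Poly_Mapping.keys (simplicial_boundary m c) \<subseteq> K"
      by (intro K(3)) (auto simp: tuples_def)
    moreover from this have "Poly_Mapping.keys (shift_chain m (simplicial_boundary m c)) \<subseteq> K"
      using keys_shift_chain[of m "simplicial_boundary m c"] K(1) by auto
    ultimately have "Poly_Mapping.keys (boundary m l c) \<subseteq> K"
      unfolding boundary_eq[OF that c(1)] by (intro order_trans[OF keys_diff]) auto
    then show "boundary m l c \<in> carrier (free_Abelian_group (tuples m (l - 1) \<inter> K))"
      using keys_boundary[OF that assms(1) c(1)] by simp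
  qed (simp add: boundary_add)
  show "boundary m n \<in> hom (free_Abelian_group (tuples m n \<inter> K)) (free_Abelian_group (tuples m (n - 1) \<inter> K))"
    "boundary m (n + 1) \<in> hom (free_Abelian_group (tuples m (n + 1) \<inter> K)) (free_Abelian_group (tuples m n \<inter> K))"
    using hom[of n] hom[of "n + 1"] assms(2) by simp_all
  show "finite (diffs m ` (tuples m n \<inter> K))"
    using finite_tuples by blast
  show "orbit_map m \<in> hom (free_Abelian_group (tuples m n \<inter> K)) (free_Abelian_group (diffs m ` (tuples m n \<inter> K)))"
  proof (rule homI)
    fix c assume "c \<in> carrier (free_Abelian_group (tuples m n \<inter> K))"
    then show "orbit_map m c \<in> carrier (free_Abelian_group (diffs m ` (tuples m n \<inter> K)))"
      using order_trans[OF keys_orbit_map image_mono] by simp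
  qed (simp add: orbit_map_add)
  show "\<exists>z\<in>carrier (free_Abelian_group (tuples m n \<inter> K)). boundary m n z =
      \<one>\<^bsub>free_Abelian_group (tuples m (n - 1) \<inter> K)\<^esub> \<and> orbit_map m z = frag_cmul (int m) (frag_of i)"
    if "i \<in> diffs m ` (tuples m n \<inter> K)" for i
  proof -
    from that obtain xs where xs: "xs \<in> tuples m n" "xs \<in> K" "i = diffs m xs" by blast
    have "Poly_Mapping.keys (orbit_sum m (frag_of xs)) \<subseteq> tuples m n \<inter> K"
      using xs K(1) shift_tuples[OF assms(1)] by (intro keys_orbit_sum) auto
    then show ?thesis
      using xs boundary_orbit_sum[of n m "frag_of xs"] assms
      by (intro bexI[of _ "orbit_sum m (frag_of xs)"])
        (auto simp: orbit_map_orbit_sum orbit_map_frag_of)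
  qed
  show "\<exists>l::nat. l > 0 \<and> z [^]\<^bsub>free_Abelian_group (tuples m n \<inter> K)\<^esub> l \<in>
      boundary m (n + 1) ` carrier (free_Abelian_group (tuples m (n + 1) \<inter> K))"
    if z: "z \<in> carrier (free_Abelian_group (tuples m n \<inter> K))"
      "boundary m n z = \<one>\<^bsub>free_Abelian_group (tuples m (n - 1) \<inter> K)\<^esub>" "orbit_map m z = 0" for z
  proof -
    have kz: "Poly_Mapping.keys z \<subseteq> tuples m n" "Poly_Mapping.keys z \<subseteq> K" using z(1) by auto
    \<comment> \<open>The chain h Q z will have boundary m z.\<close>
    define w where "w = cone m 0 (shift_quotient m z)"
    have "Poly_Mapping.keys (shift_quotient m z) \<subseteq> tuples m n"
      using kz shift_tuples[OF assms(1)] by (intro keys_shift_quotient) auto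
    then have w_t: "Poly_Mapping.keys w \<subseteq> tuples m (n + 1)"
      unfolding w_def by (rule keys_cone_tuples[OF assms(1)])
    have "Poly_Mapping.keys (shift_quotient m z) \<subseteq> K"
      using kz K(1) by (intro keys_shift_quotient) auto
    then have w_X: "Poly_Mapping.keys w \<subseteq> K"
      unfolding w_def using keys_cone[of m 0 "shift_quotient m z"] K(2) by auto
    have "orbit_sum m z = 0"
      using orbit_sum_eq_0 kz z by blast
    \<comment> \<open>The relative set is empty here, so the support condition is the equation m z =
      (T - 1) \<delta> w.\<close>
    then have "Poly_Mapping.keys (frag_cmul (int m) z -
        (shift_chain m (simplicial_boundary m w) - simplicial_boundary m w)) \<subseteq> {}"
      unfolding w_def using kz(1) z(2) boundary_eq[OF assms(2) kz(1)]
      by (intro relative_cycle_torsion[OF assms(1)]) (auto simp: tuples_def)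
    then have "frag_cmul (int m) z = boundary m (n + 1) w"
      using boundary_eq[of "n + 1" w m] w_t by simp
    moreover have "w \<in> carrier (free_Abelian_group (tuples m (n + 1) \<inter> K))"
      using w_t w_X by simp
    ultimately show ?thesis
      using assms(1) by (intro exI[of _ m]) (simp only: pow_free_Abelian_group image_eqI simp_thms)
  qed
next
  fix c assume "c \<in> carrier (free_Abelian_group (tuples m (n + 1) \<inter> K))"
  then have "Poly_Mapping.keys c \<subseteq> tuples m (n + 1)" by simp
  then show "boundary m n (boundary m (n + 1) c) = \<one>\<^bsub>free_Abelian_group (tuples m (n - 1) \<inter> K)\<^esub>"
    "orbit_map m (boundary m (n + 1) c) = 0"
    by (simp_all only: boundary_boundary[OF assms(2,1)] one_free_Abelian_group orbit_map_boundary[OF le_add2])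
qed (use assms(1) in \<open>simp_all add: abelian_free_Abelian_group\<close>)

lemma carrier_DYB: "carrier (DYB m n) = carrier (free_Abelian_group (tuples m n \<inter> degenerate m))"
proof (intro equalityI subsetI)
  fix c assume "c \<in> carrier (DYB m n)"
  then have "c \<in> generate (YB m n) (carrier (YB m n) \<inter> frag_of ` degenerate_tuples m n)"
    by (simp add: DYB_def carrier_subgroup_generated)
  then have "c \<in> carrier (YB m n) \<and> Poly_Mapping.keys c \<subseteq> tuples m n \<inter> degenerate m"
  proof induction
    case (eng x y)
    then show ?case using keys_add[of x y] by (auto simp: YB_def)
  qed (auto simp: YB_def degenerate_tuples_eq)
  then show "c \<in> carrier (free_Abelian_group (tuples m n \<inter> degenerate m))" by simp
next
  fix c assume "c \<in> carrier (free_Abelian_group (tuples m n \<inter> degenerate m))"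
  then have c: "Poly_Mapping.keys c \<subseteq> tuples m n \<inter> degenerate m" by simp
  show "c \<in> carrier (DYB m n)"
  proof (rule free_Abelian_group_induct[OF c])
    have sub: "subgroup (carrier (DYB m n)) (YB m n)"
      by (simp add: DYB_def YB_def group.subgroup_subgroup_generated)
    show "0 \<in> carrier (DYB m n)"
      using subgroup.one_closed[OF sub] by (simp add: YB_def)
    fix x y assume "x \<in> carrier (DYB m n)" "y \<in> carrier (DYB m n)"
    moreover from this have "Poly_Mapping.keys y \<subseteq> tuples m n"
      using subgroup.mem_carrier[OF sub] by (simp add: YB_def)
    ultimately show "x - y \<in> carrier (DYB m n)"
      using subgroup.m_closed[OF sub _ subgroup.m_inv_closed[OF sub], of x y] by (simp add: YB_def)
  next
    fix xs assume "xs \<in> tuples m n \<inter> degenerate m"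
    then show "frag_of xs \<in> carrier (DYB m n)"
      by (auto simp: DYB_def YB_def carrier_subgroup_generated degenerate_tuples_eq intro!: generate.incl)
  qed
qed

text \<open>Brings the degenerate complex into the form that \<open>group_rank_subcomplex\<close>
  takes.\<close>

lemma DYB_eq: "DYB m n = free_Abelian_group (tuples m n \<inter> degenerate m)"
proof -
  have "DYB m n = (YB m n)\<lparr>carrier := carrier (DYB m n)\<rparr>"
    by (simp add: DYB_def subgroup_generated_def)
  then show ?thesis
    unfolding carrier_DYB by (simp add: YB_def free_Abelian_group_def)
qed

section \<open>The quotient complex\<close>

text \<open>Makes the setwise formula in \<open>NYB_boundary\<close> computable on representatives:
  \<open>h\<close> maps \<open>N\<close> into \<open>M\<close>, which absorbs it.\<close>

lemma (in group_hom) set_mult_hom_image_rcoset: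
  assumes N: "subgroup N G" and M: "subgroup M H" and "h ` N \<subseteq> M" and x: "x \<in> carrier G"
  shows "M <#>\<^bsub>H\<^esub> h ` (N #> x) = M #>\<^bsub>H\<^esub> h x"
proof (intro equalityI subsetI)
  fix y assume "y \<in> M <#>\<^bsub>H\<^esub> h ` (N #> x)"
  then obtain a b where ab: "a \<in> M" "b \<in> N" "y = a \<otimes>\<^bsub>H\<^esub> h (b \<otimes> x)"
    by (auto simp: set_mult_def r_coset_def)
  then have "y = (a \<otimes>\<^bsub>H\<^esub> h b) \<otimes>\<^bsub>H\<^esub> h x"
    using subgroup.mem_carrier[OF N] subgroup.mem_carrier[OF M] x by (simp add: H.m_assoc)
  moreover have "a \<otimes>\<^bsub>H\<^esub> h b \<in> M"
    using ab assms(3) subgroup.m_closed[OF M] by blast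
  ultimately show "y \<in> M #>\<^bsub>H\<^esub> h x" by (auto simp: r_coset_def)
next
  fix y assume "y \<in> M #>\<^bsub>H\<^esub> h x"
  then obtain a where a: "a \<in> M" "y = a \<otimes>\<^bsub>H\<^esub> h x" by (auto simp: r_coset_def)
  moreover have "x \<in> N #> x" using G.rcos_self[OF x N] .
  ultimately show "y \<in> M <#>\<^bsub>H\<^esub> h ` (N #> x)" by (auto simp: set_mult_def)
qed

lemma YB_eq: "YB m n = free_Abelian_group (tuples m n \<inter> UNIV)"
  by (simp add: YB_def)

lemma boundary_hom_YB:
  assumes "m > 0" "n \<ge> 1"
  shows "boundary m n \<in> hom (YB m n) (YB m (n - 1))"
  using keys_boundary[OF assms(2,1)] by (auto simp: hom_def YB_def boundary_add)

lemma boundary_DYB: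
  assumes "m > 0" "n \<ge> 1" "c \<in> carrier (DYB m n)"
  shows "boundary m n c \<in> carrier (DYB m (n - 1))"
proof -
  have c: "Poly_Mapping.keys c \<subseteq> tuples m n" "Poly_Mapping.keys c \<subseteq> degenerate m"
    using assms(3) by (auto simp: carrier_DYB)
  then have "Poly_Mapping.keys (simplicial_boundary m c) \<subseteq> degenerate m"
    by (intro simplicial_boundary_degenerate) (auto simp: tuples_def)
  moreover from this have "Poly_Mapping.keys (shift_chain m (simplicial_boundary m c)) \<subseteq> degenerate m"
    using keys_shift_chain[of m "simplicial_boundary m c"] shift_degenerate[of _ m] by blast
  ultimately have "Poly_Mapping.keys (boundary m n c) \<subseteq> degenerate m"
    unfolding boundary_eq[OF assms(2) c(1)] by (intro order_trans[OF keys_diff]) auto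
  then show ?thesis
    using keys_boundary[OF assms(2,1) c(1)] by (simp add: carrier_DYB)
qed

lemma subgroup_DYB: "subgroup (carrier (DYB m n)) (YB m n)"
  by (simp add: DYB_def YB_def group.subgroup_subgroup_generated)

lemma normal_DYB: "carrier (DYB m n) \<lhd> YB m n"
  using comm_group.normal_iff_subgroup[OF abelian_free_Abelian_group] subgroup_DYB by (metis YB_def)

lemma NYB_boundary_rcoset:
  assumes "m > 0" "n \<ge> 1" "c \<in> carrier (YB m n)"
  shows "NYB_boundary m n (carrier (DYB m n) #>\<^bsub>YB m n\<^esub> c) =
    carrier (DYB m (n - 1)) #>\<^bsub>YB m (n - 1)\<^esub> boundary m n c"
proof -
  interpret group_hom "YB m n" "YB m (n - 1)" "boundary m n"
    using boundary_hom_YB[OF assms(1,2)] by (simp add: group_hom_def group_hom_axioms_def YB_def)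
  show ?thesis
    unfolding NYB_boundary_def
    using boundary_DYB[OF assms(1,2)] assms(3)
    by (intro set_mult_hom_image_rcoset subgroup_DYB) auto
qed

lemma carrier_NYB: "carrier (NYB m n) = (\<lambda>c. carrier (DYB m n) #>\<^bsub>YB m n\<^esub> c) ` carrier (YB m n)"
  by (simp add: NYB_def carrier_FactGroup)

text \<open>Translates equations in the quotient complex into the support conditions of
  \<open>relative_cycle_torsion\<close>.\<close>

lemma rcoset_DYB_eq_iff:
  assumes "x \<in> carrier (YB m n)" "y \<in> carrier (YB m n)"
  shows "carrier (DYB m n) #>\<^bsub>YB m n\<^esub> x = carrier (DYB m n) #>\<^bsub>YB m n\<^esub> y
    \<longleftrightarrow> Poly_Mapping.keys (x - y) \<subseteq> degenerate m"
proof -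
  interpret G: group "YB m n" by (simp add: YB_def)
  have "carrier (DYB m n) #>\<^bsub>YB m n\<^esub> x = carrier (DYB m n) #>\<^bsub>YB m n\<^esub> y
    \<longleftrightarrow> x - y \<in> carrier (DYB m n)"
  proof
    assume "carrier (DYB m n) #>\<^bsub>YB m n\<^esub> x = carrier (DYB m n) #>\<^bsub>YB m n\<^esub> y"
    then have "x \<in> carrier (DYB m n) #>\<^bsub>YB m n\<^esub> y"
      using G.rcos_self[OF assms(1) subgroup_DYB] by simp
    then show "x - y \<in> carrier (DYB m n)"
      by (auto simp: r_coset_def YB_def)
  next
    assume "x - y \<in> carrier (DYB m n)"
    then have "x \<in> carrier (DYB m n) #>\<^bsub>YB m n\<^esub> y"
      by (force simp: r_coset_def YB_def)
    then show "carrier (DYB m n) #>\<^bsub>YB m n\<^esub> x = carrier (DYB m n) #>\<^bsub>YB m n\<^esub> y"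
      using G.repr_independence[OF _ assms(2) subgroup_DYB] by simp
  qed
  moreover have "Poly_Mapping.keys (x - y) \<subseteq> tuples m n"
    using assms keys_diff[of x y] by (auto simp: YB_def)
  ultimately show ?thesis by (simp add: carrier_DYB)
qed

text \<open>The argument for subcomplexes, carried out modulo degenerate chains: cosets are handled
  by representatives, and only orbits of nondegenerate tuples are counted.\<close>

lemma group_rank_H_NYB:
  assumes "m > 0" "n \<ge> 1"
  shows "group_rank (H_NYB m n) = card (diffs m ` (tuples m n - degenerate m))"
proof -
  let ?D = "\<lambda>l. carrier (DYB m l)"
  let ?coset = "\<lambda>l c. carrier (DYB m l) #>\<^bsub>YB m l\<^esub> c"
  let ?F = "free_Abelian_group (diffs m ` (tuples m n - degenerate m))"
  have one: "\<one>\<^bsub>NYB m l\<^esub> = ?coset l 0" for l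
    using group.coset_mult_one[of "YB m l" "?D l"] subgroup.subset[OF subgroup_DYB]
    by (simp add: NYB_def YB_def)
  have zero: "0 \<in> carrier (YB m l)" for l by (simp add: YB_def)
  have group_NYB: "group (NYB m l)" for l
    unfolding NYB_def by (rule normal.factorgroup_is_group[OF normal_DYB])
  have coset_add: "?coset l x <#>\<^bsub>YB m l\<^esub> ?coset l y = ?coset l (x + y)"
    if "x \<in> carrier (YB m l)" "y \<in> carrier (YB m l)" for l x y
    using normal.rcos_sum[OF normal_DYB that] by (simp add: YB_def)
  have hom: "NYB_boundary m l \<in> hom (NYB m l) (NYB m (l - 1))" if "l \<ge> 1" for l
  proof -
    have bd: "boundary m l c \<in> carrier (YB m (l - 1))" if "c \<in> carrier (YB m l)" for c
      using boundary_hom_YB[OF assms(1) \<open>l \<ge> 1\<close>] that by (auto simp: hom_def)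
    have add: "x + y \<in> carrier (YB m l)" if "x \<in> carrier (YB m l)" "y \<in> carrier (YB m l)" for x y
      using that keys_add[of x y] by (auto simp: YB_def)
    show ?thesis
    proof (rule homI)
      fix A assume "A \<in> carrier (NYB m l)"
      then show "NYB_boundary m l A \<in> carrier (NYB m (l - 1))"
        using NYB_boundary_rcoset[OF assms(1) that] bd by (auto simp: carrier_NYB)
    next
      fix A B assume "A \<in> carrier (NYB m l)" "B \<in> carrier (NYB m l)"
      then obtain x y where "x \<in> carrier (YB m l)" "y \<in> carrier (YB m l)"
          "A = ?coset l x" "B = ?coset l y"
        by (auto simp: carrier_NYB)
      then show "NYB_boundary m l (A \<otimes>\<^bsub>NYB m l\<^esub> B) =
          NYB_boundary m l A \<otimes>\<^bsub>NYB m (l - 1)\<^esub> NYB_boundary m l B"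
        using bd add by (simp add: NYB_def coset_add NYB_boundary_rcoset[OF assms(1) that] boundary_add)
    qed
  qed
  \<comment> \<open>The orbit map with degenerate tuples sent to 0. Degeneracy is shift-invariant,
    so \<open>p\<close> does not see T and kills boundaries; as it vanishes on degenerate chains, it
    descends to the quotient as \<open>g\<close>.\<close>
  define p where "p = frag_extend (\<lambda>xs. if xs \<in> degenerate m then 0 else frag_of (diffs m xs))"
  have p_diff: "p (x - y) = p x - p y" for x y by (simp add: p_def frag_extend_diff)
  have p_degenerate: "p c = 0" if "Poly_Mapping.keys c \<subseteq> degenerate m" for c
    unfolding p_def by (rule frag_extend_eq_0) (use that in auto)
  have p_orbit: "p c = orbit_map m c" if "Poly_Mapping.keys c \<inter> degenerate m = {}" for c
    unfolding p_def orbit_map_def by (rule frag_extend_eq) (use that in auto)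
  have p_shift: "p (shift_chain m c) = p c" for c
    by (rule frag_additive_eqI[of c UNIV]) (simp_all add: p_diff, simp add: p_def degenerate_def)
  have p_boundary: "p (boundary m (n + 1) c) = 0" if "c \<in> carrier (YB m (n + 1))" for c
    using that boundary_eq[of "n + 1" c m] by (simp add: YB_def p_diff p_shift)
  interpret G: group "YB m n" by (simp add: YB_def)
  have "p \<in> hom (YB m n) ?F"
  proof (rule homI)
    fix c assume "c \<in> carrier (YB m n)"
    then have "Poly_Mapping.keys c \<subseteq> tuples m n" by (simp add: YB_def)
    then show "p c \<in> carrier ?F"
      unfolding p_def carrier_free_Abelian_group_iff
      by (intro order_trans[OF keys_frag_extend] UN_least) auto
  qed (simp add: p_def YB_def frag_extend_add)
  then interpret p: group_hom "YB m n" ?F p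
    by (simp add: group_hom_def group_hom_axioms_def YB_def)
  have "?D n \<subseteq> kernel (YB m n) ?F p"
    using subgroup.subset[OF subgroup_DYB] p_degenerate by (auto simp: kernel_def carrier_DYB)
  then obtain g where g: "g \<in> hom (NYB m n) ?F" "\<And>c. c \<in> carrier (YB m n) \<Longrightarrow> g (?coset n c) = p c"
    using p.FactGroup_universal_kernel[OF normal_DYB] unfolding NYB_def by blast
  have one_iff: "?coset l c = \<one>\<^bsub>NYB m l\<^esub> \<longleftrightarrow> Poly_Mapping.keys c \<subseteq> degenerate m"
    if "c \<in> carrier (YB m l)" for l c
    unfolding one rcoset_DYB_eq_iff[OF that zero] by simp
  have bd: "boundary m n c \<in> carrier (YB m (n - 1))" if "c \<in> carrier (YB m n)" for c
    using boundary_hom_YB[OF assms] that by (auto simp: hom_def)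
  have bd': "boundary m (n + 1) c \<in> carrier (YB m n)" if "c \<in> carrier (YB m (n + 1))" for c
    using boundary_hom_YB[OF assms(1), of "n + 1"] that by (auto simp: hom_def)
  show ?thesis
    unfolding H_NYB_def
  proof (rule group_rank_homology[where h = g and k = "int m"])
    show "comm_group (NYB m n)"
      unfolding NYB_def YB_def
      by (rule comm_group.abelian_FactGroup[OF abelian_free_Abelian_group])
        (use subgroup_DYB in \<open>simp add: YB_def\<close>)
    show "group (NYB m (n - 1))" "group (NYB m (n + 1))"
      by (rule group_NYB)+
    show "NYB_boundary m n \<in> hom (NYB m n) (NYB m (n - 1))"
      by (rule hom[OF assms(2)])
    show "NYB_boundary m (n + 1) \<in> hom (NYB m (n + 1)) (NYB m n)"
      using hom[of "n + 1"] by simp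
    show "finite (diffs m ` (tuples m n - degenerate m))"
      using finite_tuples by blast
    show "g \<in> hom (NYB m n) ?F" by (rule g)
    show "int m > 0" using assms by simp
  next
    fix A assume "A \<in> carrier (NYB m (n + 1))"
    then obtain c where c: "c \<in> carrier (YB m (n + 1))" "A = ?coset (n + 1) c"
      by (auto simp: carrier_NYB)
    have A: "NYB_boundary m (n + 1) A = ?coset n (boundary m (n + 1) c)"
      using NYB_boundary_rcoset[of m "n + 1" c] assms c by simp
    have "boundary m n (boundary m (n + 1) c) = 0"
      using boundary_boundary[OF assms(2,1)] c by (simp add: YB_def)
    then show "NYB_boundary m n (NYB_boundary m (n + 1) A) = \<one>\<^bsub>NYB m (n - 1)\<^esub>"
      unfolding A NYB_boundary_rcoset[OF assms bd'[OF c(1)]] by (simp add: one)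
    show "g (NYB_boundary m (n + 1) A) = 0"
      unfolding A g(2)[OF bd'[OF c(1)]] by (rule p_boundary[OF c(1)])
  next
    fix i assume "i \<in> diffs m ` (tuples m n - degenerate m)"
    then obtain xs where xs: "xs \<in> tuples m n" "xs \<notin> degenerate m" "i = diffs m xs" by auto
    \<comment> \<open>The orbit sum of a nondegenerate tuple has only nondegenerate terms, so
      \<open>p\<close> agrees with \<open>orbit_map\<close> on it.\<close>
    define z where "z = orbit_sum m (frag_of xs)"
    have z: "Poly_Mapping.keys z \<subseteq> tuples m n"
      unfolding z_def by (rule keys_orbit_sum) (use xs shift_tuples[OF assms(1)] in auto)
    have z': "Poly_Mapping.keys z \<subseteq> - degenerate m"
      unfolding z_def by (rule keys_orbit_sum) (use xs in \<open>auto simp: degenerate_def\<close>)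
    from z have zc: "z \<in> carrier (YB m n)" by (simp add: YB_def)
    have "boundary m n z = 0"
      unfolding z_def using xs by (intro boundary_orbit_sum assms) simp
    then have "NYB_boundary m n (?coset n z) = \<one>\<^bsub>NYB m (n - 1)\<^esub>"
      unfolding NYB_boundary_rcoset[OF assms zc] by (simp add: one)
    moreover have "p z = orbit_map m z"
      using z' by (intro p_orbit) auto
    then have "g (?coset n z) = frag_cmul (int m) (frag_of i)"
      unfolding g(2)[OF zc] by (simp add: z_def orbit_map_orbit_sum orbit_map_frag_of xs)
    ultimately show "\<exists>z\<in>carrier (NYB m n). NYB_boundary m n z = \<one>\<^bsub>NYB m (n - 1)\<^esub> \<and>
        g z = frag_cmul (int m) (frag_of i)"
      using zc by (auto simp: carrier_NYB)
  next
    fix A assume A: "A \<in> carrier (NYB m n)" "NYB_boundary m n A = \<one>\<^bsub>NYB m (n - 1)\<^esub>" "g A = 0"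
    then obtain c where c: "c \<in> carrier (YB m n)" "A = ?coset n c"
      by (auto simp: carrier_NYB)
    \<comment> \<open>Passing from \<open>c\<close> to its nondegenerate part \<open>z\<close> keeps
      the coset. On \<open>z\<close> the map \<open>p\<close> is the orbit map, so
      \<open>g A = 0\<close> makes the orbit sum of \<open>z\<close> vanish outright and not only
      modulo degenerate chains.\<close>
    then have "Poly_Mapping.keys c \<subseteq> (tuples m n - degenerate m) \<union> (tuples m n \<inter> degenerate m)"
      by (auto simp: YB_def)
    then obtain z e where ze: "Poly_Mapping.keys z \<subseteq> tuples m n - degenerate m"
        "Poly_Mapping.keys e \<subseteq> tuples m n \<inter> degenerate m" "z + e = c"
      by (rule frag_split)
    then have zc: "z \<in> carrier (YB m n)" "Poly_Mapping.keys z \<subseteq> tuples m n" by (auto simp: YB_def)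
    have "c - z = e" using ze(3) by auto
    then have Az: "A = ?coset n z"
      unfolding c(2) rcoset_DYB_eq_iff[OF c(1) zc(1)] using ze(2) by auto
    have "Poly_Mapping.keys (boundary m n z) \<subseteq> degenerate m"
      using A(2) one_iff[OF bd[OF zc(1)]] unfolding Az NYB_boundary_rcoset[OF assms zc(1)] by simp
    then have cycle: "Poly_Mapping.keys (shift_chain m (simplicial_boundary m z) - simplicial_boundary m z)
        \<subseteq> degenerate m"
      using boundary_eq[OF assms(2) zc(2)] by simp
    have "orbit_map m z = 0"
      using A(3) g(2)[OF zc(1)] p_orbit[of z] ze(1) unfolding Az by auto
    then have "orbit_sum m z = 0"
      using orbit_sum_eq_0 zc(2) by blast
    define w where "w = cone m 0 (shift_quotient m z)"
    have "Poly_Mapping.keys (shift_quotient m z) \<subseteq> tuples m n"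
      using zc(2) shift_tuples[OF assms(1)] by (intro keys_shift_quotient) auto
    then have w: "Poly_Mapping.keys w \<subseteq> tuples m (n + 1)"
      unfolding w_def by (rule keys_cone_tuples[OF assms(1)])
    then have wc: "w \<in> carrier (YB m (n + 1))" by (simp add: YB_def)
    \<comment> \<open>Here the relative set is \<open>degenerate m\<close>: m z and the boundary of
      \<open>w\<close> agree up to degenerate chains, so the class of \<open>A\<close> is
      \<open>m\<close>-torsion.\<close>
    have "Poly_Mapping.keys (frag_cmul (int m) z - boundary m (n + 1) w) \<subseteq> degenerate m"
      unfolding boundary_eq[OF le_add2 w] unfolding w_def
      by (rule relative_cycle_torsion[OF assms(1) _ \<open>orbit_sum m z = 0\<close> shift_degenerate Cons_degenerate cycle])
        (use zc(2) in \<open>auto simp: tuples_def\<close>)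
    moreover have "frag_cmul (int m) z \<in> carrier (YB m n)"
      using zc(2) keys_cmul[of "int m" z] by (auto simp: YB_def)
    ultimately have "?coset n (frag_cmul (int m) z) = ?coset n (boundary m (n + 1) w)"
      using rcoset_DYB_eq_iff bd'[OF wc] by blast
    moreover have "A [^]\<^bsub>NYB m n\<^esub> m = ?coset n (frag_cmul (int m) z)"
      using normal.FactGroup_pow[OF normal_DYB zc(1), of m] by (simp add: NYB_def Az YB_def)
    moreover have "NYB_boundary m (n + 1) (?coset (n + 1) w) = ?coset n (boundary m (n + 1) w)"
      using NYB_boundary_rcoset[of m "n + 1" w] assms wc by simp
    ultimately have "A [^]\<^bsub>NYB m n\<^esub> m = NYB_boundary m (n + 1) (?coset (n + 1) w)"
      by simp
    moreover have "?coset (n + 1) w \<in> carrier (NYB m (n + 1))"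
      using wc by (auto simp: carrier_NYB)
    ultimately show "\<exists>l::nat. l > 0 \<and> A [^]\<^bsub>NYB m n\<^esub> l \<in>
        NYB_boundary m (n + 1) ` carrier (NYB m (n + 1))"
      using assms(1) by blast
  qed
qed

theorem corollary3p7:
  fixes m n :: nat
  assumes "m \<ge> 1" and "n \<ge> 1"
  shows "group_rank (H_YB m n) = m ^ (n - 1)
       \<and> group_rank (H_D m n) = m ^ (n - 1) - (m - 1) ^ (n - 1)
       \<and> group_rank (H_NYB m n) = (m - 1) ^ (n - 1)"
proof -
  have m: "m > 0" using assms by simp
  have "group_rank (H_YB m n) = card (diffs m ` tuples m n)"
    unfolding H_YB_def YB_eq[abs_def] using group_rank_subcomplex[OF m assms(2), of UNIV] by simp
  moreover have "group_rank (H_D m n) = card (diffs m ` (tuples m n \<inter> degenerate m))"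
    unfolding H_D_def DYB_eq[abs_def]
    by (rule group_rank_subcomplex[OF m assms(2) shift_degenerate Cons_degenerate
          simplicial_boundary_degenerate])
  ultimately show ?thesis
    using group_rank_H_NYB[OF m assms(2)] card_diffs_image[OF m assms(2)] by simp
qed

end
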